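(* Let $G=(V,E)$ be a finite simple connected regular graph of degree $5$. Then \[ r(G)\geq \frac{5}{3}|V|-1. \]
   Context: For a finite simple graph $G=(V,E)$ with $V=\{v_1,\dots,v_m\}$ and a map $\mathbf{p}:V\to\mathbb{R}^2$, $\mathbf{p}(v_i)=(x_i,y_i)$, the rigidity matrix $R(\mathbf{p})$ is the $|E|\times 2m$ matrix whose row for the edge $e_{ij}=\{v_i,v_j\}$ is the vector $\mathbf{v}_{ij}=(x_i-x_j)\mathbf{b}_{2i-1}+(y_i-y_j)\mathbf{b}_{2i}+(x_j-x_i)\mathbf{b}_{2j-1}+(y_j-y_i)\mathbf{b}_{2j}\in\mathbb{R}^{2m}$, where $\mathbf{b}_k$ are the standard basis vectors. A realization $\mathbf{p}$ is generic if its $2m$ coordinates are algebraically independent over $\mathbb{Q}$. $r(G)$ denotes the rank of $R(\mathbf{p})$ for a generic $\mathbf{p}$ (the rank of the 2-dimensional generic rigidity matroid of $G$); it is independent of the generic $\mathbf{p}$ chosen. *)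

theory Defs
  imports
    "HOL.Real"
    "HOL-Library.Poly_Mapping"
    "Jordan_Normal_Form.DL_Rank"
begin

definition finite_simple_graph :: "'v set \<Rightarrow> 'v set set \<Rightarrow> bool" where
  "finite_simple_graph V E \<longleftrightarrow> finite V \<and> (\<forall>e\<in>E. e \<subseteq> V \<and> card e = 2)"

definition regular_graph :: "'v set \<Rightarrow> 'v set set \<Rightarrow> nat \<Rightarrow> bool" where
  "regular_graph V E d \<longleftrightarrow> (\<forall>v\<in>V. card {e \<in> E. v \<in> e} = d)"

definition connected_graph :: "'v set \<Rightarrow> 'v set set \<Rightarrow> bool" where
  "connected_graph V E \<longleftrightarrow> (\<forall>u\<in>V. \<forall>w\<in>V. (u, w) \<in> {(a, b). {a, b} \<in> E}\<^sup>*)"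

text \<open>
  Multivariate polynomials over the rationals in variables of type \<open>'i\<close> are finitely supported maps
  from monomials (finitely supported exponent functions) to coefficients.
\<close>

definition eval_rat_mpoly :: "(('i \<Rightarrow>\<^sub>0 nat) \<Rightarrow>\<^sub>0 rat) \<Rightarrow> ('i \<Rightarrow> real) \<Rightarrow> real" where
  "eval_rat_mpoly P x =
    (\<Sum>m \<in> Poly_Mapping.keys P. of_rat (Poly_Mapping.lookup P m) *
      (\<Prod>i \<in> Poly_Mapping.keys m. x i ^ Poly_Mapping.lookup m i))"

definition alg_independent_over_rat :: "'i set \<Rightarrow> ('i \<Rightarrow> real) \<Rightarrow> bool" where
  "alg_independent_over_rat I x \<longleftrightarrow>
    (\<forall>P :: ('i \<Rightarrow>\<^sub>0 nat) \<Rightarrow>\<^sub>0 rat.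
      (\<forall>m \<in> Poly_Mapping.keys P. Poly_Mapping.keys m \<subseteq> I) \<longrightarrow> eval_rat_mpoly P x = 0 \<longrightarrow> P = 0)"

text \<open>
  The family of the \<open>2 * card V\<close> coordinates is indexed by \<open>V \<times> UNIV\<close>, where \<open>(v, False)\<close> stands for
  the first and \<open>(v, True)\<close> for the second coordinate of \<open>p v\<close>.
\<close>

definition generic_realization :: "'v set \<Rightarrow> ('v \<Rightarrow> real \<times> real) \<Rightarrow> bool" where
  "generic_realization V p \<longleftrightarrow>
    alg_independent_over_rat (V \<times> (UNIV :: bool set)) (\<lambda>(v, b). if b then snd (p v) else fst (p v))"

text \<open>
  The list \<open>vs\<close> enumerates the vertices. Indices start at \<open>0\<close>, so vertex \<open>vs ! i\<close> owns the columns
  \<open>2 * i\<close> and \<open>2 * i + 1\<close>.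
\<close>

definition edge_vector :: "'v list \<Rightarrow> ('v \<Rightarrow> real \<times> real) \<Rightarrow> nat \<Rightarrow> nat \<Rightarrow> real vec" where
  "edge_vector vs p i j =
    (let n = 2 * length vs;
         xi = fst (p (vs ! i)); yi = snd (p (vs ! i));
         xj = fst (p (vs ! j)); yj = snd (p (vs ! j))
     in (xi - xj) \<cdot>\<^sub>v unit_vec n (2 * i) + (yi - yj) \<cdot>\<^sub>v unit_vec n (2 * i + 1)
      + (xj - xi) \<cdot>\<^sub>v unit_vec n (2 * j) + (yj - yi) \<cdot>\<^sub>v unit_vec n (2 * j + 1))"

definition rigidity_matrix :: "'v list \<Rightarrow> 'v set set \<Rightarrow> ('v \<Rightarrow> real \<times> real) \<Rightarrow> real mat" where
  "rigidity_matrix vs E p =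
    mat_of_rows (2 * length vs)
      [edge_vector vs p i j. i \<leftarrow> [0..<length vs], j \<leftarrow> [Suc i..<length vs], {vs ! i, vs ! j} \<in> E]"

text \<open>
  The rank depends neither on the enumeration of the vertices nor on the generic realization, so an
  arbitrary choice of both is made.
\<close>

definition generic_rigidity_rank :: "'v set \<Rightarrow> 'v set set \<Rightarrow> nat" where
  "generic_rigidity_rank V E =
    (let vs = (SOME vs. distinct vs \<and> set vs = V);
         p = (SOME p. generic_realization V p);
         R = rigidity_matrix vs E p
     in vec_space.rank (dim_row R) R)"

end

theory Submission
  imports Defs
    "HOL-Library.Disjoint_Sets"
    "HOL-Computational_Algebra.Polynomial"
    "HOL-Analysis.Continuum_Not_Denumerable"
    "Jordan_Normal_Form.DL_Rank_Submatrix"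
begin

text \<open>
  Let \<open>F\<close> be a maximal set of edges with \<open>card F[X] \<le> 2 * card X - 3\<close> for all vertex sets \<open>X\<close> with at least
  two elements. By Laman's theorem the rows of the rigidity matrix that belong to \<open>F\<close> are independent at
  a generic realization: a vertex of degree at most three is removed (for degree three an edge between
  two of its neighbours is added), the smaller graph is independent by induction, and putting the vertex
  back in a special position preserves independence, which then holds generically.

  By maximality every edge lies in a tight set, and two maximal tight sets share at most one vertex.
  Hence the maximal tight sets cover the edges, and the sum of \<open>2 * card X - 3\<close> over them is at most
  \<open>card F\<close>. It remains to bound this sum from below for every cover of the edges of a connected
  5-regular graph, which is done by a discharging argument: a vertex that lies in a single set \<open>X\<close> of
  the cover forces \<open>card X \<ge> 6\<close>, and connectivity accounts for the sets that are joined only by pairs.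
\<close>

section \<open>Covers of connected 5-regular graphs\<close>

text \<open>The bound is attained by the complete graph on six vertices, whose rank is 9. In a
  cover, a set of size \<open>c >= 3\<close> is worth \<open>2 * c - 3 = (c - 2) + (c - 1)\<close>
  and a pair is worth \<open>1 = 2/3 + 1/3\<close>. The first parts, shared among the vertices, must
  give every vertex 2/3. Six is the size at which one set does this alone, and a smaller set cannot
  be the only one at a vertex of degree five. The second parts must give one unit per vertex. A
  connected family of sets of size at least three on \<open>n\<close> vertices yields
  \<open>n - 1\<close>, so \<open>m\<close> components lose \<open>m\<close> units, of which the
  pairs joining them, at least \<open>m - 1\<close>, return a third each. For \<open>m >= 2\<close>
  the missing 2/3 per component has to come from a surplus of the first parts, which is why single
  components are bounded below. For \<open>m = 1\<close> the lost unit is the constant 1 of the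
  theorem.\<close>

lemma connected_hypergraph_card_le:
  fixes X :: "'i \<Rightarrow> 'a set"
  assumes "finite I" "finite U" "U \<noteq> {}" and sub: "\<And>i. i \<in> I \<Longrightarrow> X i \<subseteq> U"
    and cross: "\<And>S. S \<subseteq> U \<Longrightarrow> S \<noteq> {} \<Longrightarrow> S \<noteq> U \<Longrightarrow> \<exists>i\<in>I. X i \<inter> S \<noteq> {} \<and> \<not> X i \<subseteq> S"
  shows "card U \<le> 1 + (\<Sum>i\<in>I. card (X i) - 1)"
proof -
  \<comment> \<open>The vertices beyond the first are charged to the hyperedges contained in
    \<open>S\<close>. A crossing hyperedge meets \<open>S\<close> and so brings at most
    \<open>card (X i) - 1\<close> new ones, and it was not charged before because it was not
    contained.\<close>
  define Q where "Q S \<longleftrightarrow> S \<subseteq> U \<and> S \<noteq> {} \<and> card S \<le> 1 + (\<Sum>i\<in>{i\<in>I. X i \<subseteq> S}. card (X i) - 1)" for S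
  have grow: "\<exists>S. Q S \<and> min (Suc k) (card U) \<le> card S" for k
  proof (induction k)
    case 0
    obtain u where "u \<in> U" using \<open>U \<noteq> {}\<close> by blast
    then have "Q {u}" by (simp add: Q_def)
    then show ?case by (intro exI[of _ "{u}"]) simp
  next
    case (Suc k)
    then obtain S where S: "Q S" "min (Suc k) (card U) \<le> card S" by blast
    show ?case
    proof (cases "S = U")
      case True then show ?thesis using S by auto
    next
      case False
      have SU: "S \<subseteq> U" "S \<noteq> {}" "finite S"
        using S(1) \<open>finite U\<close> finite_subset by (auto simp: Q_def)
      then obtain i where i: "i \<in> I" "X i \<inter> S \<noteq> {}" "\<not> X i \<subseteq> S" using cross[of S] False by blast
      have fX: "finite (X i)" using sub[OF i(1)] \<open>finite U\<close> finite_subset by blast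
      have c: "card (S \<union> X i) + card (S \<inter> X i) = card S + card (X i)"
        using card_Un_Int[OF SU(3) fX] by simp
      have "card (S \<inter> X i) \<ge> 1" using i(2) fX by (simp add: Suc_le_eq card_gt_0_iff Int_commute)
      then have c1: "card (S \<union> X i) \<le> card S + (card (X i) - 1)" using c by linarith
      have "(\<Sum>j\<in>insert i {j\<in>I. X j \<subseteq> S}. card (X j) - 1)
          \<le> (\<Sum>j\<in>{j\<in>I. X j \<subseteq> S \<union> X i}. card (X j) - 1)"
        using \<open>finite I\<close> i(1) by (intro sum_mono2) auto
      moreover have "(\<Sum>j\<in>insert i {j\<in>I. X j \<subseteq> S}. card (X j) - 1)
          = card (X i) - 1 + (\<Sum>j\<in>{j\<in>I. X j \<subseteq> S}. card (X j) - 1)"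
        using i(3) \<open>finite I\<close> by (subst sum.insert) auto
      ultimately have Q: "Q (S \<union> X i)"
        using S(1) c1 SU sub[OF i(1)] by (auto simp: Q_def)
      have "card S < card (S \<union> X i)" using i(3) SU fX by (intro psubset_card_mono) auto
      then show ?thesis using Q S(2) by (intro exI[of _ "S \<union> X i"]) auto
    qed
  qed
  obtain S where S: "Q S" "min (Suc (card U)) (card U) \<le> card S" using grow by blast
  then have "S = U" using \<open>finite U\<close> by (intro card_seteq) (auto simp: Q_def)
  moreover have "{i\<in>I. X i \<subseteq> U} = I" using sub by auto
  ultimately show ?thesis using S by (simp add: Q_def)
qed

text \<open>The blocks are the classes of chaining through members of \<open>L\<close>; vertices in
  no member form singletons. The last property is the crossing hypothesis that
  \<open>connected_hypergraph_card_le\<close> asks for.\<close>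

lemma hypergraph_components:
  fixes L :: "'a set set"
  assumes "\<And>X. X \<in> L \<Longrightarrow> X \<subseteq> V"
  obtains P where "partition_on V P"
    "\<And>C X. C \<in> P \<Longrightarrow> X \<in> L \<Longrightarrow> X \<inter> C \<noteq> {} \<Longrightarrow> X \<subseteq> C"
    "\<And>C S. C \<in> P \<Longrightarrow> S \<subseteq> C \<Longrightarrow> S \<noteq> {} \<Longrightarrow> S \<noteq> C \<Longrightarrow> \<exists>X\<in>L. X \<inter> S \<noteq> {} \<and> \<not> X \<subseteq> S"
proof -
  define r where "r = {(a, b). \<exists>X\<in>L. a \<in> X \<and> b \<in> X}"
  have sym: "sym (r\<^sup>*)" by (intro sym_rtrancl) (auto simp: sym_def r_def)
  define K where "K v = r\<^sup>* `` {v}" for v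
  have K_eq: "K u = K v" if "(u, v) \<in> r\<^sup>*" for u v
    using that sym unfolding K_def sym_def by (blast intro: rtrancl_trans)
  have KV: "K v \<subseteq> V" if "v \<in> V" for v
  proof
    fix u assume "u \<in> K v"
    then have "(v, u) \<in> r\<^sup>*" by (simp add: K_def)
    then show "u \<in> V" by (induction rule: rtrancl_induct) (use that assms in \<open>auto simp: r_def\<close>)
  qed
  have "partition_on V (K ` V)"
  proof (rule partition_onI)
    show "\<Union> (K ` V) = V" using KV by (auto simp: K_def)
    show "disjnt p q" if pq: "p \<in> K ` V" "q \<in> K ` V" "p \<noteq> q" for p q
    proof -
      from pq obtain u w where "p = K u" "q = K w" by blast
      with pq(3) show ?thesis using K_eq unfolding disjnt_def K_def by blast
    qed
    show "{} \<notin> K ` V" by (auto simp: K_def)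
  qed
  moreover have "X \<subseteq> C" if CX: "C \<in> K ` V" "X \<in> L" "X \<inter> C \<noteq> {}" for C X
  proof -
    obtain v where v: "C = K v" using CX by blast
    obtain x where "x \<in> X" "(v, x) \<in> r\<^sup>*" using CX v by (auto simp: K_def)
    then have "(v, y) \<in> r\<^sup>*" if "y \<in> X" for y
      using that \<open>X \<in> L\<close> by (auto intro!: rtrancl_into_rtrancl[of v x] simp: r_def)
    then show ?thesis by (auto simp: v K_def)
  qed
  moreover have "\<exists>X\<in>L. X \<inter> S \<noteq> {} \<and> \<not> X \<subseteq> S" if C: "C \<in> K ` V" and S: "S \<subseteq> C" "S \<noteq> {}" "S \<noteq> C" for C S
  proof (rule ccontr)
    assume no: "\<not> ?thesis"
    obtain s where s: "s \<in> S" using S by blast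
    obtain v where "C = K v" using C by blast
    then have "C = K s" using s S K_eq[of v s] by (auto simp: K_def)
    moreover have "u \<in> S" if "(s, u) \<in> r\<^sup>*" for u
      using that by (induction rule: rtrancl_induct) (use s no in \<open>auto simp: r_def\<close>)
    ultimately show False using S by (auto simp: K_def)
  qed
  ultimately show ?thesis using that by blast
qed

lemma connected_graph_crossing_edge:
  assumes "connected_graph V E" "S \<subseteq> V" "S \<noteq> {}" "S \<noteq> V"
  obtains a b where "a \<in> S" "b \<notin> S" "{a, b} \<in> E"
proof -
  obtain s t where st: "s \<in> S" "t \<in> V" "t \<notin> S" using assms by blast
  have "(s, t) \<in> {(a, b). {a, b} \<in> E}\<^sup>*" using assms(1,2) st by (auto simp: connected_graph_def)
  then have "\<exists>a b. a \<in> S \<and> b \<notin> S \<and> {a, b} \<in> E" using st(1,3)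
  proof (induction rule: converse_rtrancl_induct)
    case base then show ?case by simp
  next
    case (step y z) then show ?case by blast
  qed
  then show ?thesis using that by blast
qed

lemma card_neighbours:
  assumes "finite_simple_graph V E" "regular_graph V E d" "v \<in> V"
  shows "card {u. {v, u} \<in> E} = d"
proof -
  have "bij_betw (\<lambda>u. {v, u}) {u. {v, u} \<in> E} {e \<in> E. v \<in> e}"
  proof (rule bij_betw_imageI)
    show "inj_on (\<lambda>u. {v, u}) {u. {v, u} \<in> E}"
      by (auto simp: inj_on_def doubleton_eq_iff)
    show "(\<lambda>u. {v, u}) ` {u. {v, u} \<in> E} = {e \<in> E. v \<in> e}"
    proof (intro equalityI subsetI)
      fix e assume e: "e \<in> {e \<in> E. v \<in> e}"
      then have "card e = 2" using assms(1) by (auto simp: finite_simple_graph_def)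
      then obtain a b where "e = {a, b}" by (auto simp: card_2_iff)
      with e have "\<exists>u. e = {v, u}" by auto
      with e show "e \<in> (\<lambda>u. {v, u}) ` {u. {v, u} \<in> E}" by auto
    qed auto
  qed
  then show ?thesis using assms(2,3) by (simp add: bij_betw_same_card regular_graph_def)
qed

section \<open>Discharging over an edge cover by vertex sets\<close>

locale covered_quintic_graph =
  fixes V :: "'v set" and E :: "'v set set" and XX :: "'v set set"
  assumes graph: "finite_simple_graph V E"
    and conn: "connected_graph V E"
    and reg: "regular_graph V E 5"
    and cover_sub: "X \<in> XX \<Longrightarrow> X \<subseteq> V"
    and cover_card: "X \<in> XX \<Longrightarrow> 2 \<le> card X"
    and cover: "e \<in> E \<Longrightarrow> \<exists>X\<in>XX. e \<subseteq> X"
begin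

text \<open>
  Weights of the discharging argument. A set \<open>X\<close> with at least three elements gives \<open>card X - 2\<close> to
  its elements in equal shares, a pair gives \<open>2 / 3\<close>, and every vertex pays \<open>2 / 3\<close>. What the sets
  keep, \<open>card X - 1\<close> or \<open>1 / 3\<close>, is what connectivity controls.
\<close>

definition wt :: "'v set \<Rightarrow> real" where
  "wt X = (if card X = 2 then 1 / 3 else 1 - 2 / real (card X))"

definition at_vertex :: "'v \<Rightarrow> 'v set set" where
  "at_vertex v = {X \<in> XX. v \<in> X}"

definition load :: "'v \<Rightarrow> real" where
  "load v = sum wt (at_vertex v) - 2 / 3"

lemma finV: "finite V" using graph by (simp add: finite_simple_graph_def)

lemma finXX: "finite XX"
  using finV cover_sub by (meson PowI finite_Pow_iff finite_subset subsetI)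

lemma fin_at: "finite (at_vertex v)" using finXX by (simp add: at_vertex_def)

lemma fin_X: "X \<in> XX \<Longrightarrow> finite X" using cover_sub finV finite_subset by blast

text \<open>Pairs and triples both weigh 1/3, the minimum, and the weight grows with the size from
  there. Six elements weigh exactly 2/3, which is what a vertex pays.\<close>

lemma wt_ge: 
  assumes "X \<in> XX"
  shows "1 / 3 \<le> wt X" "4 \<le> card X \<Longrightarrow> 1 / 2 \<le> wt X" "5 \<le> card X \<Longrightarrow> 3 / 5 \<le> wt X"
    "6 \<le> card X \<Longrightarrow> 2 / 3 \<le> wt X"
  using cover_card[OF assms] by (auto simp: wt_def field_simps)

lemma wt_nonneg: "X \<in> at_vertex v \<Longrightarrow> 0 \<le> wt X"
  using wt_ge(1)[of X] by (simp add: at_vertex_def)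

lemma load_ge:
  assumes "A \<subseteq> at_vertex v" shows "sum wt A - 2 / 3 \<le> load v"
  using sum_mono2[OF fin_at assms, of wt] wt_nonneg by (auto simp: load_def)

text \<open>All five neighbours of \<open>v\<close> lie in the sets at \<open>v\<close>, and a set
  \<open>X\<close> supplies at most \<open>card X - 1\<close> of them.\<close>

lemma degree_le:
  assumes "v \<in> V" shows "5 \<le> (\<Sum>X\<in>at_vertex v. card X - 1)"
proof -
  have "{u. {v, u} \<in> E} \<subseteq> (\<Union>X\<in>at_vertex v. X - {v})"
  proof
    fix u assume u: "u \<in> {u. {v, u} \<in> E}"
    then have "card {v, u} = 2" using graph unfolding finite_simple_graph_def by blast
    then have "u \<noteq> v" by auto
    then show "u \<in> (\<Union>X\<in>at_vertex v. X - {v})" using u cover by (fastforce simp: at_vertex_def)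
  qed
  then have "card {u. {v, u} \<in> E} \<le> card (\<Union>X\<in>at_vertex v. X - {v})"
    using fin_at fin_X by (intro card_mono finite_UN_I) (auto simp: at_vertex_def)
  also have "\<dots> \<le> (\<Sum>X\<in>at_vertex v. card (X - {v}))" by (rule card_UN_le[OF fin_at])
  also have "\<dots> = (\<Sum>X\<in>at_vertex v. card X - 1)" by (rule sum.cong) (auto simp: at_vertex_def)
  finally show ?thesis using card_neighbours[OF graph reg assms] by simp
qed

text \<open>A set of at most five elements supplies at most four of the five neighbours.\<close>

lemma another_set:
  assumes "v \<in> V" "X \<in> at_vertex v" "card X \<le> 5"
  obtains Y where "Y \<in> at_vertex v" "Y \<noteq> X"
proof (rule ccontr)
  assume "\<not> thesis"
  then have "at_vertex v = {X}" using assms that by blast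
  then show False using degree_le[OF assms(1)] assms(3) by simp
qed

lemma load_two:
  assumes "X \<in> at_vertex v" "Y \<in> at_vertex v" "X \<noteq> Y"
  shows "wt X + wt Y - 2 / 3 \<le> load v"
  using load_ge[of "{X, Y}" v] assms by simp

lemma load_three:
  assumes "X \<in> at_vertex v" "Y \<in> at_vertex v" "Z \<in> at_vertex v" "X \<noteq> Y" "X \<noteq> Z" "Y \<noteq> Z"
  shows "1 / 3 \<le> load v"
proof -
  have "wt X + (wt Y + wt Z) - 2 / 3 \<le> load v" using load_ge[of "{X, Y, Z}" v] assms by simp
  moreover have "1 / 3 \<le> wt X" "1 / 3 \<le> wt Y" "1 / 3 \<le> wt Z"
    using assms wt_ge(1) by (auto simp: at_vertex_def)
  ultimately show ?thesis by linarith
qed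

lemma at_vertex_nonempty: "v \<in> V \<Longrightarrow> at_vertex v \<noteq> {}"
  using degree_le[of v] by auto

text \<open>A set of six or more elements pays the 2/3 alone; a smaller one is accompanied by a
  second set, and two weights sum to at least 2/3.\<close>

lemma load_nonneg:
  assumes "v \<in> V" shows "0 \<le> load v"
proof -
  obtain X where X: "X \<in> at_vertex v" using at_vertex_nonempty[OF assms] by blast
  then have XX: "X \<in> XX" by (simp add: at_vertex_def)
  show ?thesis
  proof (cases "card X \<le> 5")
    case True
    then obtain Y where Y: "Y \<in> at_vertex v" "Y \<noteq> X" using another_set[OF assms X] by blast
    then show ?thesis using load_two[OF X Y(1)] wt_ge(1)[OF XX] wt_ge(1)[of Y] by (auto simp: at_vertex_def)
  next
    case False
    then show ?thesis using load_ge[of "{X}" v] wt_ge(4)[OF XX] X by auto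
  qed
qed

text \<open>The surplus is at least \<open>1/2 + 1/3 - 2/3\<close>. Four such vertices reach the 2/3
  that a component needs.\<close>

lemma load_medium:
  assumes "v \<in> X" "X \<in> XX" "4 \<le> card X" "card X \<le> 5"
  shows "1 / 6 \<le> load v"
proof -
  have X: "X \<in> at_vertex v" "v \<in> V" using assms cover_sub by (auto simp: at_vertex_def)
  obtain Y where Y: "Y \<in> at_vertex v" "Y \<noteq> X" using another_set[OF X(2,1) assms(4)] by blast
  then show ?thesis using load_two[OF X(1) Y(1)] wt_ge(2)[OF assms(2,3)] wt_ge(1)[of Y]
    by (auto simp: at_vertex_def)
qed

text \<open>If only \<open>Y\<close> accompanies the triple, degree five forces
  \<open>card Y >= 4\<close>, and the exclusion of 4 and 5 lifts this to six, so the surplus is at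
  least \<open>1/3 + 2/3 - 2/3\<close>. With three sets it is at least
  \<open>3 * 1/3 - 2/3\<close>.\<close>

lemma load_triple:
  assumes "v \<in> X" "X \<in> XX" "card X = 3"
    and no: "\<And>Y. Y \<in> at_vertex v \<Longrightarrow> card Y \<noteq> 4 \<and> card Y \<noteq> 5"
  shows "1 / 3 \<le> load v"
proof -
  have X: "X \<in> at_vertex v" "v \<in> V" using assms cover_sub by (auto simp: at_vertex_def)
  obtain Y where Y: "Y \<in> at_vertex v" "Y \<noteq> X" using another_set[OF X(2,1)] assms(3) by auto
  show ?thesis
  proof (cases "at_vertex v = {X, Y}")
    case True
    then have "5 \<le> (card X - 1) + (card Y - 1)" using degree_le[OF X(2)] Y(2) by simp
    then have "6 \<le> card Y" using assms(3) no[OF Y(1)] by linarith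
    then show ?thesis using load_two[OF X(1) Y(1)] Y wt_ge(1)[OF assms(2)] wt_ge(4)[of Y]
      by (auto simp: at_vertex_def)
  next
    case False
    then obtain Z where "Z \<in> at_vertex v" "Z \<noteq> X" "Z \<noteq> Y" using X Y by blast
    then show ?thesis using load_three[OF X(1) Y(1)] Y by auto
  qed
qed

lemma load_shared_large:
  assumes "X \<in> at_vertex v" "Y \<in> at_vertex v" "X \<noteq> Y" "6 \<le> card X"
  shows "1 / 3 \<le> load v"
  using load_two[OF assms(1-3)] wt_ge(4)[of X] wt_ge(1)[of Y] assms by (auto simp: at_vertex_def)

text \<open>
  The critical case is a single set with at least six elements that one edge joins to the rest of the
  graph: with exactly six elements some vertex would have degree six.
\<close>

lemma load_component_ge:
  assumes CV: "C \<subseteq> V" "C \<noteq> {}" "C \<noteq> V"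
    and closed: "\<And>X. X \<in> XX \<Longrightarrow> 3 \<le> card X \<Longrightarrow> X \<inter> C \<noteq> {} \<Longrightarrow> X \<subseteq> C"
    and cross: "\<And>S. S \<subseteq> C \<Longrightarrow> S \<noteq> {} \<Longrightarrow> S \<noteq> C \<Longrightarrow> \<exists>X\<in>XX. 3 \<le> card X \<and> X \<inter> S \<noteq> {} \<and> \<not> X \<subseteq> S"
  shows "2 / 3 \<le> sum load C"
proof -
  have finC: "finite C" using CV finV finite_subset by blast
  have nonneg: "v \<in> C \<Longrightarrow> 0 \<le> load v" for v using load_nonneg CV by blast
  have sub: "sum load A \<le> sum load C" if "A \<subseteq> C" for A
    using that nonneg by (intro sum_mono2[OF finC]) auto
  have by_set: "2 / 3 \<le> sum load C" if "X \<subseteq> C" "\<And>v. v \<in> X \<Longrightarrow> c \<le> load v" "2 / 3 \<le> real (card X) * c" for X c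
    using sub[OF that(1)] sum_bounded_below[of X c load] that(2,3) by force
  \<comment> \<open>Sizes four and five come before triples, because \<open>load_triple\<close>
    relies on their absence. The surpluses are then at least \<open>4 * 1/6\<close> and
    \<open>3 * 1/3\<close>.\<close>
  consider (med) X where "X \<in> XX" "X \<subseteq> C" "4 \<le> card X" "card X \<le> 5"
    | (triple) X where "X \<in> XX" "X \<subseteq> C" "card X = 3"
        "\<And>Y. Y \<in> XX \<Longrightarrow> Y \<subseteq> C \<Longrightarrow> card Y \<noteq> 4 \<and> card Y \<noteq> 5"
    | (large) "\<And>X. X \<in> XX \<Longrightarrow> X \<inter> C \<noteq> {} \<Longrightarrow> card X = 2 \<or> 6 \<le> card X"
  proof (cases "\<exists>X\<in>XX. X \<subseteq> C \<and> 3 \<le> card X \<and> card X \<le> 5")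
    case True
    show ?thesis
    proof (cases "\<exists>X\<in>XX. X \<subseteq> C \<and> 4 \<le> card X \<and> card X \<le> 5")
      case True then show ?thesis using med by blast
    next
      case False
      from \<open>\<exists>X\<in>XX. X \<subseteq> C \<and> 3 \<le> card X \<and> card X \<le> 5\<close> obtain X
        where X: "X \<in> XX" "X \<subseteq> C" "3 \<le> card X" "card X \<le> 5" by blast
      have "card X = 3" using False X by (metis Suc_leI eval_nat_numeral(3) le_neq_implies_less numeral_eq_Suc numeral_nat)
      moreover have "card Y \<noteq> 4 \<and> card Y \<noteq> 5" if "Y \<in> XX" "Y \<subseteq> C" for Y
        using False that by force
      ultimately show ?thesis using triple X by blast
    qed
  next
    case False
    have "card X = 2 \<or> 6 \<le> card X" if "X \<in> XX" "X \<inter> C \<noteq> {}" for X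
    proof (cases "3 \<le> card X")
      case True then show ?thesis using False closed[OF that(1) True that(2)] that by force
    next
      case False then show ?thesis using cover_card[OF that(1)] by linarith
    qed
    then show ?thesis using large by blast
  qed
  then show ?thesis
  proof cases
    case med
    then show ?thesis using load_medium[of _ X] by (intro by_set[of X "1/6"]) auto
  next
    case triple
    have "1 / 3 \<le> load v" if "v \<in> X" for v
    proof (rule load_triple[OF that triple(1,3)])
      fix Y assume Y: "Y \<in> at_vertex v"
      show "card Y \<noteq> 4 \<and> card Y \<noteq> 5"
      proof (cases "3 \<le> card Y")
        case True
        have "Y \<subseteq> C" using closed[OF _ True] Y that triple(2) by (auto simp: at_vertex_def)
        then show ?thesis using triple(4)[of Y] Y by (simp add: at_vertex_def)
      qed auto
    qed
    then show ?thesis using triple by (intro by_set[of X "1/3"]) auto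
  next
    case large
    \<comment> \<open>No set of size three or more can cover an edge that leaves the component, so
      this edge is covered by a pair \<open>Z\<close>.\<close>
    obtain v z where vz: "v \<in> C" "z \<notin> C" "{v, z} \<in> E"
      using connected_graph_crossing_edge[OF conn CV(1,2)] CV(3) by blast
    then obtain Z where Z: "Z \<in> XX" "{v, z} \<subseteq> Z" using cover by blast
    have "\<not> 3 \<le> card Z" using closed[OF Z(1)] Z vz by auto
    then have cardZ: "card Z = 2" using cover_card[OF Z(1)] by linarith
    have Zv: "Z \<in> at_vertex v" using Z by (simp add: at_vertex_def)
    show ?thesis
    proof (cases "\<exists>X\<in>at_vertex v. 6 \<le> card X")
      case False
      \<comment> \<open>Only pairs meet at \<open>v\<close>, hence at least five of them, with
        surplus at least \<open>5/3 - 2/3\<close>.\<close>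
      then have two: "card X = 2" if "X \<in> at_vertex v" for X
        using large[of X] that vz by (auto simp: at_vertex_def)
      then have "5 \<le> card (at_vertex v)" using degree_le[of v] vz CV by (auto simp: subset_iff)
      moreover have "sum wt (at_vertex v) = real (card (at_vertex v)) * (1 / 3)"
        using two by (simp add: wt_def)
      ultimately have "2 / 3 \<le> load v" by (simp add: load_def)
      then show ?thesis using by_set[of "{v}" "2/3"] vz by simp
    next
      case True
      then obtain X where X: "X \<in> at_vertex v" "6 \<le> card X" by blast
      have XX: "X \<in> XX" "v \<in> X" using X by (auto simp: at_vertex_def)
      have XC: "X \<subseteq> C" using closed[of X] X vz by (auto simp: at_vertex_def)
      have finX: "finite X" using fin_X XX by blast
      have XZ: "X \<noteq> Z" using X cardZ by auto
      have lv: "1 / 3 \<le> load v" using load_shared_large[OF X(1) Zv XZ X(2)] .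
      \<comment> \<open>\<open>C\<close> contains the six or more elements of \<open>X\<close>, so
        \<open>{u}\<close> is a proper part of it and is crossed by a set that is not a pair; in
        this case such a set has at least six elements.\<close>
      have in_large: "\<exists>Y\<in>at_vertex u. 6 \<le> card Y" if "u \<in> C" for u
      proof -
        have "\<exists>Y\<in>XX. 3 \<le> card Y \<and> Y \<inter> {u} \<noteq> {} \<and> \<not> Y \<subseteq> {u}"
        proof (rule cross)
          have "card X \<le> card C" using XC finC by (rule card_mono[rotated])
          then show "{u} \<noteq> C" using X by auto
        qed (use that in auto)
        then obtain Y where "Y \<in> XX" "3 \<le> card Y" "u \<in> Y" by auto
        then show ?thesis using large[of Y] that by (auto simp: at_vertex_def)
      qed
      show ?thesis
      proof (cases "\<exists>u\<in>C - {v}. \<exists>Y\<in>at_vertex u. \<exists>Y'\<in>at_vertex u. Y \<noteq> Y'")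
        case True
        \<comment> \<open>The vertex \<open>v\<close> has surplus 1/3, and a second vertex lying in
          two sets contributes the other 1/3.\<close>
        then obtain u Y Y' where u: "u \<in> C" "u \<noteq> v" "Y \<in> at_vertex u" "Y' \<in> at_vertex u" "Y \<noteq> Y'" by blast
        obtain Y0 where Y0: "Y0 \<in> at_vertex u" "6 \<le> card Y0" using in_large u by blast
        obtain Y1 where "Y1 \<in> at_vertex u" "Y1 \<noteq> Y0" using u by metis
        then have "1 / 3 \<le> load u" using load_shared_large Y0 by metis
        then show ?thesis using lv u vz by (intro by_set[of "{u, v}" "1/3"]) auto
      next
        case False
        show ?thesis
        proof (cases "at_vertex v = {X, Z}")
          case False
          \<comment> \<open>A third set at \<open>v\<close> raises the surplus to at least
            \<open>2/3 + 1/3 + 1/3 - 2/3\<close>.\<close>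
          then obtain Y where Y: "Y \<in> at_vertex v" "Y \<noteq> X" "Y \<noteq> Z" using X Zv by blast
          have "sum wt {X, Y, Z} - 2 / 3 \<le> load v" by (rule load_ge) (use X Y Zv in auto)
          then have "wt X + wt Y + wt Z - 2 / 3 \<le> load v" using Y XZ by auto
          moreover have "2 / 3 \<le> wt X" "1 / 3 \<le> wt Y" "1 / 3 \<le> wt Z"
            using X Y Zv wt_ge(4)[of X] wt_ge(1) by (auto simp: at_vertex_def)
          ultimately have "2 / 3 \<le> load v" by linarith
          then show ?thesis using by_set[of "{v}" "2/3"] vz by simp
        next
          case True
          note uniq = \<open>\<not> (\<exists>u\<in>C - {v}. \<exists>Y\<in>at_vertex u. \<exists>Y'\<in>at_vertex u. Y \<noteq> Y')\<close>
          have only: "at_vertex u = {X}" if "u \<in> X" "u \<noteq> v" for u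
          proof -
            have "X \<in> at_vertex u" "u \<in> C - {v}" using that XX XC by (auto simp: at_vertex_def)
            then show ?thesis using uniq by blast
          qed
          have nb: "{w. {u, w} \<in> E} \<subseteq> X - {u}" if "u \<in> X" "u \<noteq> v" for u
          proof
            fix w assume w: "w \<in> {w. {u, w} \<in> E}"
            then obtain Y where Y: "Y \<in> XX" "{u, w} \<subseteq> Y" using cover by blast
            then have "Y = X" using only[OF that] by (auto simp: at_vertex_def)
            moreover have "card {u, w} = 2" using w graph unfolding finite_simple_graph_def by blast
            then have "u \<noteq> w" by auto
            ultimately show "w \<in> X - {u}" using Y by auto
          qed
          \<comment> \<open>With six elements, every vertex of \<open>X\<close> other than
            \<open>v\<close> finds its five neighbours only by being adjacent to all of
            \<open>X\<close>. Then \<open>v\<close> has five neighbours in \<open>X\<close> and the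
            sixth neighbour \<open>z\<close>.\<close>
          have "card X \<noteq> 6"
          proof
            assume c6: "card X = 6"
            have "v \<in> {w. {u, w} \<in> E}" if u: "u \<in> X" "u \<noteq> v" for u
            proof -
              have "u \<in> V" using u XC CV by blast
              then have "card {w. {u, w} \<in> E} = 5" using card_neighbours[OF graph reg] by blast
              moreover have "card (X - {u}) = 5" using c6 u finX by simp
              ultimately have "{w. {u, w} \<in> E} = X - {u}"
                using nb[OF u] finX by (intro card_subset_eq) auto
              then show ?thesis using u XX by auto
            qed
            then have "insert z (X - {v}) \<subseteq> {w. {v, w} \<in> E}" using vz by (auto simp: insert_commute)
            moreover have "finite {w. {v, w} \<in> E}"
              using card_neighbours[OF graph reg, of v] vz CV by (metis card.infinite subsetD zero_neq_numeral)
            ultimately have "card (insert z (X - {v})) \<le> card {w. {v, w} \<in> E}" by (rule card_mono[rotated])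
            moreover have "card (insert z (X - {v})) = 6" using c6 finX XX XC vz by (subst card_insert_disjoint) auto
            moreover have "card {w. {v, w} \<in> E} = 5"
              using card_neighbours[OF graph reg, of v] vz CV by blast
            ultimately show False by linarith
          qed
          then have c7: "7 \<le> card X" using X by linarith
          have wX: "wt X = 1 - 2 / real (card X)" using c7 by (simp add: wt_def)
          have "sum load X = load v + sum load (X - {v})" by (rule sum.remove[OF finX XX(2)])
          also have "sum load (X - {v}) = real (card (X - {v})) * (wt X - 2 / 3)"
            using only by (simp add: load_def)
          also have "real (card (X - {v})) = real (card X) - 1" using finX XX c7 by (simp add: of_nat_diff)
          also have "load v = wt X + 1 / 3 - 2 / 3" using True XZ cardZ by (simp add: load_def wt_def)
          \<comment> \<open>The surplus \<open>card X / 3 - 5 / 3\<close> is only 1/3 for six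
            elements and reaches 2/3 exactly at seven.\<close>
          also have "wt X + 1 / 3 - 2 / 3 + (real (card X) - 1) * (wt X - 2 / 3) = real (card X) / 3 - 5 / 3"
            using c7 by (simp add: wX field_simps)
          finally have "2 / 3 \<le> sum load X" using c7 by simp
          then show ?thesis using sub[OF XC] by linarith
        qed
      qed
    qed
  qed
qed

text \<open>Double counting: a set contributes \<open>card X * wt X\<close>, which is
  \<open>card X - 2\<close>, or \<open>2 / 3\<close> for a pair.\<close>

lemma sum_load:
  "sum load V = (\<Sum>X | X \<in> XX \<and> 3 \<le> card X. real (card X) - 2) + 2 / 3 * real (card {X \<in> XX. card X = 2})
    - 2 / 3 * real (card V)"
proof -
  have "(\<Sum>v\<in>V. sum wt (at_vertex v)) = (\<Sum>X\<in>XX. \<Sum>v | v \<in> V \<and> v \<in> X. wt X)"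
    unfolding at_vertex_def by (rule sum.swap_restrict[OF finV finXX])
  also have "\<dots> = (\<Sum>X\<in>XX. real (card X) * wt X)"
  proof (rule sum.cong)
    fix X assume "X \<in> XX"
    then have "{v. v \<in> V \<and> v \<in> X} = X" using cover_sub by blast
    then show "(\<Sum>v | v \<in> V \<and> v \<in> X. wt X) = real (card X) * wt X" by simp
  qed simp
  also have "\<dots> = (\<Sum>X\<in>{X. X \<in> XX \<and> 3 \<le> card X} \<union> {X \<in> XX. card X = 2}. real (card X) * wt X)"
  proof (rule sum.cong)
    show "XX = {X. X \<in> XX \<and> 3 \<le> card X} \<union> {X \<in> XX. card X = 2}" using cover_card by force
  qed simp
  also have "\<dots> = (\<Sum>X | X \<in> XX \<and> 3 \<le> card X. real (card X) * wt X)
      + (\<Sum>X\<in>{X \<in> XX. card X = 2}. real (card X) * wt X)"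
    using finXX by (intro sum.union_disjoint) auto
  also have "(\<Sum>X | X \<in> XX \<and> 3 \<le> card X. real (card X) * wt X) = (\<Sum>X | X \<in> XX \<and> 3 \<le> card X. real (card X) - 2)"
    by (rule sum.cong) (auto simp: wt_def field_simps)
  also have "(\<Sum>X\<in>{X \<in> XX. card X = 2}. real (card X) * wt X) = 2 / 3 * real (card {X \<in> XX. card X = 2})"
    by (simp add: wt_def)
  finally show ?thesis by (simp add: load_def sum_subtractf)
qed

lemma cover_weight_ge:
  assumes "V \<noteq> {}"
  shows "5 / 3 * real (card V) - 1 \<le> (\<Sum>X\<in>XX. 2 * real (card X) - 3)"
proof -
  define L where "L = {X. X \<in> XX \<and> 3 \<le> card X}"
  define T where "T = {X \<in> XX. card X = 2}"
  have fin: "finite L" "finite T" using finXX by (auto simp: L_def T_def)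
  have "(\<Sum>X\<in>XX. 2 * real (card X) - 3) = (\<Sum>X\<in>L \<union> T. 2 * real (card X) - 3)"
  proof (rule sum.cong)
    show "XX = L \<union> T" unfolding L_def T_def using cover_card by force
  qed simp
  also have "\<dots> = (\<Sum>X\<in>L. 2 * real (card X) - 3) + (\<Sum>X\<in>T. 2 * real (card X) - 3)"
    using fin by (intro sum.union_disjoint) (auto simp: L_def T_def)
  also have "(\<Sum>X\<in>T. 2 * real (card X) - 3) = real (card T)" by (simp add: T_def)
  also have "(\<Sum>X\<in>L. 2 * real (card X) - 3) = (\<Sum>X\<in>L. real (card X) - 2) + (\<Sum>X\<in>L. real (card X) - 1)"
    by (simp add: sum.distrib[symmetric] algebra_simps)
  finally have total: "(\<Sum>X\<in>XX. 2 * real (card X) - 3)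
      = (\<Sum>X\<in>L. real (card X) - 2) + (\<Sum>X\<in>L. real (card X) - 1) + real (card T)" .
  have loads: "sum load V = (\<Sum>X\<in>L. real (card X) - 2) + 2 / 3 * real (card T) - 2 / 3 * real (card V)"
    using sum_load by (simp add: L_def T_def)
  obtain P where P: "partition_on V P"
    "\<And>C X. C \<in> P \<Longrightarrow> X \<in> L \<Longrightarrow> X \<inter> C \<noteq> {} \<Longrightarrow> X \<subseteq> C"
    "\<And>C S. C \<in> P \<Longrightarrow> S \<subseteq> C \<Longrightarrow> S \<noteq> {} \<Longrightarrow> S \<noteq> C \<Longrightarrow> \<exists>X\<in>L. X \<inter> S \<noteq> {} \<and> \<not> X \<subseteq> S"
    using hypergraph_components[of L V] cover_sub unfolding L_def by blast
  have PV: "\<Union>P = V" "{} \<notin> P" "disjoint P" using P(1) by (auto simp: partition_on_def)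
  have finP: "finite P" using finite_elements[OF finV P(1)] .
  have finC: "finite C" if "C \<in> P" for C using that PV finV by (metis Sup_upper finite_subset)
  have sumP: "sum f V = (\<Sum>C\<in>P. sum f C)" for f :: "'v \<Rightarrow> real"
    using sum.Union_disjoint[of P f] PV finC by (auto simp: disjoint_def)
  \<comment> \<open>Each block is a connected hypergraph under the members of \<open>L\<close>
    inside it. A member of \<open>L\<close> lies in at most one block, so the bounds for the blocks
    add up.\<close>
  have spanning: "real (card V) - real (card P) \<le> (\<Sum>X\<in>L. real (card X) - 1)"
  proof -
    have "real (card C) - 1 \<le> (\<Sum>X | X \<in> L \<and> X \<subseteq> C. real (card X) - 1)" if C: "C \<in> P" for C
    proof -
      have "card C \<le> 1 + (\<Sum>X | X \<in> L \<and> X \<subseteq> C. card X - 1)"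
      proof (rule connected_hypergraph_card_le)
        show "\<exists>X\<in>{X. X \<in> L \<and> X \<subseteq> C}. X \<inter> S \<noteq> {} \<and> \<not> X \<subseteq> S" if S: "S \<subseteq> C" "S \<noteq> {}" "S \<noteq> C" for S
        proof -
          obtain X where X: "X \<in> L" "X \<inter> S \<noteq> {}" "\<not> X \<subseteq> S" using P(3)[OF C S] by blast
          then have "X \<subseteq> C" using P(2)[OF C X(1)] S by blast
          then show ?thesis using X by blast
        qed
      qed (use C PV fin finC in auto)
      then have "real (card C) \<le> 1 + (\<Sum>X | X \<in> L \<and> X \<subseteq> C. real (card X - 1))"
        by (metis of_nat_1 of_nat_add of_nat_le_iff of_nat_sum)
      also have "(\<Sum>X | X \<in> L \<and> X \<subseteq> C. real (card X - 1)) = (\<Sum>X | X \<in> L \<and> X \<subseteq> C. real (card X) - 1)"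
        by (rule sum.cong) (auto simp: L_def of_nat_diff)
      finally show ?thesis by simp
    qed
    then have "(\<Sum>C\<in>P. real (card C) - 1) \<le> (\<Sum>C\<in>P. \<Sum>X | X \<in> L \<and> X \<subseteq> C. real (card X) - 1)"
      by (rule sum_mono)
    also have "\<dots> = (\<Sum>X\<in>(\<Union>C\<in>P. {X. X \<in> L \<and> X \<subseteq> C}). real (card X) - 1)"
    proof (rule sum.UNION_disjoint[symmetric])
      show "\<forall>C\<in>P. \<forall>D\<in>P. C \<noteq> D \<longrightarrow> {X. X \<in> L \<and> X \<subseteq> C} \<inter> {X. X \<in> L \<and> X \<subseteq> D} = {}"
      proof (intro ballI impI)
        fix C D assume CD: "C \<in> P" "D \<in> P" "C \<noteq> D"
        have "X = {}" if "X \<subseteq> C" "X \<subseteq> D" for X using that CD PV(3) unfolding disjoint_def by blast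
        moreover have "{} \<notin> L" by (simp add: L_def)
        ultimately show "{X. X \<in> L \<and> X \<subseteq> C} \<inter> {X. X \<in> L \<and> X \<subseteq> D} = {}" by auto
      qed
    qed (use finP fin in auto)
    also have "\<dots> \<le> (\<Sum>X\<in>L. real (card X) - 1)"
      by (rule sum_mono2) (use fin in \<open>auto simp: L_def\<close>)
    finally have "(\<Sum>C\<in>P. real (card C) - 1) \<le> (\<Sum>X\<in>L. real (card X) - 1)" .
    moreover have "(\<Sum>C\<in>P. real (card C)) = real (card V)" using sumP[of "\<lambda>_. 1"] by simp
    ultimately show ?thesis by (simp add: sum_subtractf)
  qed
  show ?thesis
  proof (cases "V \<in> P")
    case True
    have "P = {V}"
    proof -
      have "C = V" if "C \<in> P" for C
      proof (rule ccontr)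
        assume "C \<noteq> V"
        then have "C \<inter> V = {}" using True that PV(3) unfolding disjoint_def by blast
        moreover have "C \<subseteq> V" "C \<noteq> {}" using that PV by auto
        ultimately show False by blast
      qed
      then show ?thesis using True by blast
    qed
    \<comment> \<open>With a single block the loss in \<open>spanning\<close> is exactly the
      constant 1, and nonnegative loads suffice.\<close>
    then have "real (card P) = 1" by simp
    moreover have "0 \<le> sum load V" using load_nonneg by (intro sum_nonneg) auto
    ultimately show ?thesis using total loads spanning by simp
  next
    case False
    \<comment> \<open>For \<open>m = card P\<close> the balance against
      \<open>5 / 3 * card V\<close> is at least
      \<open>2/3 * m + (m - 1) / 3 - m = - 1/3\<close>.\<close>
    have "2 / 3 \<le> sum load C" if C: "C \<in> P" for C
    proof (rule load_component_ge)
      show "\<exists>X\<in>XX. 3 \<le> card X \<and> X \<inter> S \<noteq> {} \<and> \<not> X \<subseteq> S" if "S \<subseteq> C" "S \<noteq> {}" "S \<noteq> C" for S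
        using P(3)[OF C that] by (auto simp: L_def)
      show "X \<subseteq> C" if "X \<in> XX" "3 \<le> card X" "X \<inter> C \<noteq> {}" for X
        using P(2)[OF C _ that(3)] that by (auto simp: L_def)
    qed (use C PV False in auto)
    then have "(\<Sum>C\<in>P. 2 / 3) \<le> (\<Sum>C\<in>P. sum load C)" by (rule sum_mono)
    then have "2 / 3 * real (card P) \<le> sum load V" using sumP[of load] by simp
    moreover have "card P \<le> 1 + card T"
    proof -
      \<comment> \<open>Contracting every block to a point turns the pairs into a connected
        hypergraph on \<open>P\<close>. A pair inside one block has a one-element image and
        contributes 0.\<close>
      define part where "part v = (THE C. C \<in> P \<and> v \<in> C)" for v
      have part_eq: "part v = C" if "C \<in> P" "v \<in> C" for v C
        unfolding part_def using that PV(3) by (intro the_equality) (auto simp: disjoint_def)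
      have part_in: "part v \<in> P \<and> v \<in> part v" if "v \<in> V" for v
        using that part_eq PV(1) by (metis UnionE)
      have card_img: "card (part ` X) - 1 \<le> 1" if "X \<in> T" for X
      proof -
        have "finite X" using that fin_X by (auto simp: T_def)
        then show ?thesis using card_image_le[of X part] that by (simp add: T_def)
      qed
      have "card P \<le> 1 + (\<Sum>X\<in>T. card (part ` X) - 1)"
      proof (rule connected_hypergraph_card_le)
        show "P \<noteq> {}" using PV assms by auto
        show "part ` X \<subseteq> P" if "X \<in> T" for X using that cover_sub part_in by (auto simp: T_def)
        show "\<exists>X\<in>T. part ` X \<inter> S \<noteq> {} \<and> \<not> part ` X \<subseteq> S" if S: "S \<subseteq> P" "S \<noteq> {}" "S \<noteq> P" for S
        proof -
          have "\<Union>S \<subseteq> V" using S PV by auto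
          moreover have "\<Union>S \<noteq> {}" using S PV(2) by (metis Union_empty_conv all_not_in_conv subsetD)
          moreover have "\<Union>S \<noteq> V"
          proof
            assume SV: "\<Union>S = V"
            obtain C where C: "C \<in> P" "C \<notin> S" using S by blast
            then obtain x where x: "x \<in> C" using PV by (metis all_not_in_conv)
            then have "x \<in> \<Union>S" using SV PV C by auto
            then obtain D where "D \<in> S" "x \<in> D" by blast
            then show False using part_eq[of C x] part_eq[of D x] C x S by auto
          qed
          ultimately obtain a b where ab: "a \<in> \<Union>S" "b \<notin> \<Union>S" "{a, b} \<in> E"
            using connected_graph_crossing_edge[OF conn] by blast
          obtain X where X: "X \<in> XX" "{a, b} \<subseteq> X" using cover ab by blast
          obtain C where C: "C \<in> S" "a \<in> C" using ab by blast
          have bV: "b \<in> V" using X cover_sub by blast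
          have pb: "part b \<notin> S" using part_in[OF bV] ab(2) by blast
          \<comment> \<open>A larger set covering the crossing edge would lie inside one block of
            \<open>S\<close>, so only a pair can cover it.\<close>
          have "X \<notin> L"
          proof
            assume "X \<in> L"
            then have "X \<subseteq> C" using P(2)[of C X] C S X by blast
            then show False using X C ab by blast
          qed
          then have "X \<in> T" using X cover_card[of X] by (auto simp: L_def T_def)
          moreover have "part a \<in> S" using part_eq[of C a] C S by auto
          ultimately show ?thesis using X pb by (intro bexI[of _ X]) auto
        qed
      qed (use fin finP in auto)
      also have "\<dots> \<le> 1 + (\<Sum>X\<in>T. 1)" using sum_mono[OF card_img, of T] by simp
      finally show ?thesis by simp
    qed
    then have "real (card P) \<le> 1 + real (card T)" by linarith
    ultimately show ?thesis using total loads spanning by linarith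
  qed
qed

end

section \<open>Sparse graphs\<close>

definition induced :: "'v set set \<Rightarrow> 'v set \<Rightarrow> 'v set set" where
  "induced F X = {e \<in> F. e \<subseteq> X}"

text \<open>Laman's count \<open>2 * card X - 3\<close>, with the 3 moved to the left so that no
  subtraction of naturals truncates.\<close>

definition sparse :: "'v set \<Rightarrow> 'v set set \<Rightarrow> bool" where
  "sparse V F \<longleftrightarrow> finite_simple_graph V F \<and>
    (\<forall>X\<subseteq>V. 2 \<le> card X \<longrightarrow> card (induced F X) + 3 \<le> 2 * card X)"

definition tight :: "'v set set \<Rightarrow> 'v set \<Rightarrow> bool" where
  "tight F X \<longleftrightarrow> 2 \<le> card X \<and> card (induced F X) + 3 = 2 * card X"

lemma sparse_finite:
  assumes "sparse V F" shows "finite V" "finite F"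
  using assms finite_subset[of F "Pow V"] by (auto simp: sparse_def finite_simple_graph_def)

lemma sparseD: "sparse V F \<Longrightarrow> X \<subseteq> V \<Longrightarrow> 2 \<le> card X \<Longrightarrow> card (induced F X) + 3 \<le> 2 * card X"
  by (simp add: sparse_def)

lemma finite_induced [simp]: "finite F \<Longrightarrow> finite (induced F X)"
  by (simp add: induced_def)

text \<open>Edges within both sets are those within the intersection; edges joining
  \<open>X - Y\<close> to \<open>Y - X\<close> count only for the union.\<close>

lemma induced_supermodular:
  assumes "finite F"
  shows "card (induced F X) + card (induced F Y) \<le> card (induced F (X \<union> Y)) + card (induced F (X \<inter> Y))"
proof -
  have "card (induced F X) + card (induced F Y)
      = card (induced F X \<union> induced F Y) + card (induced F X \<inter> induced F Y)"
    using assms by (intro card_Un_Int) auto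
  also have "induced F X \<inter> induced F Y = induced F (X \<inter> Y)" by (auto simp: induced_def)
  also have "card (induced F X \<union> induced F Y) \<le> card (induced F (X \<union> Y))"
    using assms by (intro card_mono) (auto simp: induced_def)
  finally show ?thesis by simp
qed

text \<open>By supermodularity the counts of union and intersection sum to at least
  \<open>2 * card X + 2 * card Y - 6\<close>. Sparsity bounds each of them from above, so both
  bounds are attained; two common vertices let the bound apply to the intersection.\<close>

lemma tight_Un:
  assumes F: "sparse V F" and X: "tight F X" "X \<subseteq> V" and Y: "tight F Y" "Y \<subseteq> V"
    and "2 \<le> card (X \<inter> Y)"
  shows "tight F (X \<union> Y)"
proof -
  have fin: "finite X" "finite Y" using X Y sparse_finite[OF F] finite_subset by auto
  have c: "card X + card Y = card (X \<union> Y) + card (X \<inter> Y)" using card_Un_Int[OF fin] .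
  have "card (induced F X) + card (induced F Y) \<le> card (induced F (X \<union> Y)) + card (induced F (X \<inter> Y))"
    using induced_supermodular sparse_finite[OF F] by blast
  moreover have "card (induced F (X \<inter> Y)) + 3 \<le> 2 * card (X \<inter> Y)"
    using sparseD[OF F] X assms(6) by blast
  moreover have le: "card (X \<inter> Y) \<le> card (X \<union> Y)" using fin by (intro card_mono) auto
  moreover have "card (induced F (X \<union> Y)) + 3 \<le> 2 * card (X \<union> Y)"
    using sparseD[OF F, of "X \<union> Y"] X Y assms(6) le by auto
  ultimately show ?thesis using X Y c assms(6) unfolding tight_def by linarith
qed

lemma sparse_delete_vertex:
  assumes "sparse V F" shows "sparse (V - {v}) {e \<in> F. v \<notin> e}"
proof -
  have "card (induced {e \<in> F. v \<notin> e} X) \<le> card (induced F X)" for X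
    using sparse_finite[OF assms] by (intro card_mono) (auto simp: induced_def)
  note le = this
  have "card (induced {e \<in> F. v \<notin> e} X) + 3 \<le> 2 * card X" if "X \<subseteq> V - {v}" "2 \<le> card X" for X
  proof -
    have "X \<subseteq> V" using that by blast
    then show ?thesis using sparseD[OF assms, of X] le[of X] that(2) by linarith
  qed
  then show ?thesis using assms by (auto simp: sparse_def finite_simple_graph_def)
qed

text \<open>Only sets containing both ends gain an edge, and a set that is not tight has room for
  one.\<close>

lemma sparse_insert_edge:
  assumes F: "sparse V F" and e: "a \<in> V" "b \<in> V" "a \<noteq> b"
    and no: "\<And>X. X \<subseteq> V \<Longrightarrow> {a, b} \<subseteq> X \<Longrightarrow> \<not> tight F X"
  shows "sparse V (insert {a, b} F)"
proof -
  have "card (induced (insert {a, b} F) X) + 3 \<le> 2 * card X" if X: "X \<subseteq> V" "2 \<le> card X" for X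
  proof (cases "{a, b} \<subseteq> X")
    case True
    have "induced (insert {a, b} F) X = insert {a, b} (induced F X)" using True by (auto simp: induced_def)
    then have "card (induced (insert {a, b} F) X) \<le> Suc (card (induced F X))"
      by (simp add: card_insert_le_m1 card_insert_if sparse_finite[OF F])
    moreover have "card (induced F X) + 3 < 2 * card X"
      using no[OF X(1) True] sparseD[OF F X] X by (auto simp: tight_def)
    ultimately show ?thesis by linarith
  next
    case False
    then have "induced (insert {a, b} F) X = induced F X" by (auto simp: induced_def)
    then show ?thesis using sparseD[OF F X] by simp
  qed
  then show ?thesis using F e by (auto simp: sparse_def finite_simple_graph_def)
qed

lemma sum_incidence:
  assumes "finite V" "finite F" "\<And>e. e \<in> F \<Longrightarrow> e \<subseteq> V \<and> card e = 2"
  shows "(\<Sum>v\<in>V. card {e \<in> F. v \<in> e}) = 2 * card F"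
proof -
  have "(\<Sum>v\<in>V. card {e \<in> F. v \<in> e}) = (\<Sum>v\<in>V. \<Sum>e | e \<in> F \<and> v \<in> e. 1)" by simp
  also have "\<dots> = (\<Sum>e\<in>F. \<Sum>v | v \<in> V \<and> v \<in> e. 1)" by (rule sum.swap_restrict[OF assms(1,2)])
  also have "\<dots> = (\<Sum>e\<in>F. 2)"
  proof (rule sum.cong)
    fix e assume e: "e \<in> F"
    then have "{v. v \<in> V \<and> v \<in> e} = e" using assms(3) by blast
    then show "(\<Sum>v | v \<in> V \<and> v \<in> e. 1) = (2::nat)" using assms(3) e by simp
  qed simp
  finally show ?thesis by simp
qed

text \<open>The degree sum is at most \<open>4 * card V - 6\<close>, so not all degrees are four or
  more; with fewer than two vertices there are no edges.\<close>

lemma sparse_low_degree_vertex: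
  assumes F: "sparse V F" and "V \<noteq> {}"
  obtains v where "v \<in> V" "card {e \<in> F. v \<in> e} \<le> 3"
proof -
  have fin: "finite V" "finite F" using sparse_finite[OF F] .
  have e: "e \<subseteq> V \<and> card e = 2" if "e \<in> F" for e
    using that F by (auto simp: sparse_def finite_simple_graph_def)
  have le: "2 * card F < 4 * card V"
  proof (cases "2 \<le> card V")
    case True
    have "induced F V = F" using e by (auto simp: induced_def)
    then show ?thesis using sparseD[OF F subset_refl True] by simp
  next
    case False
    have "F = {}" using e False fin card_mono by (metis equals0I)
    then show ?thesis using assms fin by (simp add: card_gt_0_iff)
  qed
  have "\<exists>v\<in>V. card {e \<in> F. v \<in> e} \<le> 3"
  proof (rule ccontr)
    assume "\<not> ?thesis"
    then have "\<And>v. v \<in> V \<Longrightarrow> 4 \<le> card {e \<in> F. v \<in> e}" by force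
    then have "card V * 4 \<le> (\<Sum>v\<in>V. card {e \<in> F. v \<in> e})"
      using sum_bounded_below[of V 4 "\<lambda>v. card {e \<in> F. v \<in> e}"] by simp
    then show False using sum_incidence[OF fin e] le by simp
  qed
  then show ?thesis using that by blast
qed

text \<open>Adding \<open>v\<close> to \<open>X\<close> would add three edges but raise the bound
  only by two.\<close>

lemma no_tight_contains_neighbours:
  assumes F: "sparse V F" and v: "v \<in> V" and three: "card {e \<in> F. v \<in> e} = 3"
    and X: "X \<subseteq> V - {v}" "tight F X" and nb: "\<And>e. e \<in> F \<Longrightarrow> v \<in> e \<Longrightarrow> e - {v} \<subseteq> X"
  shows False
proof -
  have fin: "finite X" "finite F" using X(1) sparse_finite[OF F] finite_subset by auto
  have "card (induced F X) + card {e \<in> F. v \<in> e} = card (induced F X \<union> {e \<in> F. v \<in> e})"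
    using fin X by (subst card_Un_disjoint) (auto simp: induced_def)
  also have "\<dots> \<le> card (induced F (insert v X))"
    using fin nb by (intro card_mono) (auto simp: induced_def)
  finally have "card (induced F X) + 3 \<le> card (induced F (insert v X))" using three by simp
  moreover have "card (induced F (insert v X)) + 3 \<le> 2 * card (insert v X)"
    using F v X fin by (intro sparseD[OF F]) (auto simp: tight_def card_insert_if)
  moreover have "card (insert v X) = Suc (card X)" using X fin by (subst card_insert_disjoint) auto
  ultimately show False using X(2) by (simp add: tight_def)
qed

text \<open>Suppose each pair of neighbours of \<open>v\<close> is blocked by a tight set avoiding
  \<open>v\<close>. Any two of these sets meet in just one neighbour, since otherwise their union is
  tight and contains all three. Then the sets span \<open>2 * (card X + card Y + card Z) - 9\<close>
  distinct edges, while their union has three vertices fewer than the sum of the sizes, so the union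
  is tight and again contains all three neighbours.\<close>

lemma sparse_inverse_1_extension:
  assumes F: "sparse V F" and v: "v \<in> V" and three: "card {e \<in> F. v \<in> e} = 3"
  obtains a b c where "a \<in> V - {v}" "b \<in> V - {v}" "c \<in> V - {v}" "a \<noteq> b" "a \<noteq> c" "b \<noteq> c"
    "{e \<in> F. v \<in> e} = {{v, a}, {v, b}, {v, c}}" "{a, b} \<notin> F"
    "sparse (V - {v}) (insert {a, b} {e \<in> F. v \<notin> e})"
proof -
  have fin: "finite V" "finite F" using sparse_finite[OF F] .
  have edge: "\<exists>u\<in>V - {v}. e = {v, u}" if "e \<in> F" "v \<in> e" for e
  proof -
    have "card e = 2" "e \<subseteq> V" using that F by (auto simp: sparse_def finite_simple_graph_def)
    then show ?thesis using that(2) by (auto simp: card_2_iff)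
  qed
  obtain e1 e2 e3 where e: "{e \<in> F. v \<in> e} = {e1, e2, e3}" "e1 \<noteq> e2" "e1 \<noteq> e3" "e2 \<noteq> e3"
    using three by (auto simp: card_3_iff)
  have e': "e1 \<in> F \<and> v \<in> e1" "e2 \<in> F \<and> v \<in> e2" "e3 \<in> F \<and> v \<in> e3" using e(1) by auto
  obtain a where a: "a \<in> V - {v}" "e1 = {v, a}" using edge e' by blast
  obtain b where b: "b \<in> V - {v}" "e2 = {v, b}" using edge e' by blast
  obtain c where c: "c \<in> V - {v}" "e3 = {v, c}" using edge e' by blast
  have abc: "a \<noteq> b" "a \<noteq> c" "b \<noteq> c" using a b c e by auto
  have star: "{e \<in> F. v \<in> e} = {{v, a}, {v, b}, {v, c}}" using a b c e by auto
  define F' where "F' = {e \<in> F. v \<notin> e}"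
  have F': "sparse (V - {v}) F'" unfolding F'_def by (rule sparse_delete_vertex[OF F])
  have ind': "induced F' X = induced F X" if "X \<subseteq> V - {v}" for X
    using that by (auto simp: induced_def F'_def)
  \<comment> \<open>One notion of blocking covers both obstructions: if \<open>{x, y}\<close> is
    already an edge, the set \<open>{x, y}\<close> itself is tight.\<close>
  define cov where "cov x y X \<longleftrightarrow> X \<subseteq> V - {v} \<and> tight F X \<and> x \<in> X \<and> y \<in> X" for x y X
  have nocov: "\<not> (a \<in> X \<and> b \<in> X \<and> c \<in> X)" if "X \<subseteq> V - {v}" "tight F X" for X
    using no_tight_contains_neighbours[OF F v three that] star by blast
  have good: "{x, y} \<notin> F \<and> sparse (V - {v}) (insert {x, y} F')"
    if xy: "x \<in> V - {v}" "y \<in> V - {v}" "x \<noteq> y" "\<And>X. \<not> cov x y X" for x y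
  proof
    show "{x, y} \<notin> F"
    proof
      assume xyF: "{x, y} \<in> F"
      have "card {x, y} = 2" using xy by simp
      moreover have "card (induced F {x, y}) \<ge> 1"
        using xyF fin by (auto simp: Suc_le_eq card_gt_0_iff induced_def)
      moreover have "card (induced F {x, y}) + 3 \<le> 2 * card {x, y}"
        using xy by (intro sparseD[OF F]) auto
      ultimately have "tight F {x, y}" by (simp add: tight_def)
      then show False using xy(4)[of "{x, y}"] xy by (auto simp: cov_def)
    qed
    show "sparse (V - {v}) (insert {x, y} F')"
    proof (rule sparse_insert_edge[OF F' xy(1-3)])
      fix X assume "X \<subseteq> V - {v}" "{x, y} \<subseteq> X"
      then show "\<not> tight F' X" using xy(4)[of X] ind'[of X] by (auto simp: cov_def tight_def)
    qed
  qed
  have meet: "X \<inter> Y = {y}" if "cov x y X" "cov y z Y" "{x, y, z} = {a, b, c}" for x y z X Y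
  proof (rule ccontr)
    assume ne: "X \<inter> Y \<noteq> {y}"
    have XY: "X \<subseteq> V" "Y \<subseteq> V" "tight F X" "tight F Y" using that by (auto simp: cov_def)
    have "finite (X \<inter> Y)" using XY fin finite_subset by blast
    moreover have "y \<in> X \<inter> Y" using that by (auto simp: cov_def)
    moreover have "card (X \<inter> Y) \<noteq> 1" using ne \<open>y \<in> X \<inter> Y\<close> by (metis card_1_singletonE singletonD)
    moreover have "card (X \<inter> Y) \<noteq> 0" using calculation by auto
    ultimately have "2 \<le> card (X \<inter> Y)" by linarith
    then have "tight F (X \<union> Y)" using tight_Un[OF F XY(3,1,4,2)] by blast
    moreover have "X \<union> Y \<subseteq> V - {v}" "{x, y, z} \<subseteq> X \<union> Y" using that by (auto simp: cov_def)
    ultimately show False using nocov[of "X \<union> Y"] that(3) by auto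
  qed
  have "\<not> (cov a b X \<and> cov b c Y \<and> cov c a Z)" for X Y Z
  proof
    assume cov: "cov a b X \<and> cov b c Y \<and> cov c a Z"
    have XY: "X \<inter> Y = {b}" using meet[of a b X c Y] cov by auto
    have YZ: "Y \<inter> Z = {c}" using meet[of b c Y a Z] cov by auto
    have ZX: "Z \<inter> X = {a}" using meet[of c a Z b X] cov by auto
    have sub: "X \<subseteq> V - {v}" "Y \<subseteq> V - {v}" "Z \<subseteq> V - {v}" using cov by (auto simp: cov_def)
    have finX: "finite X" "finite Y" "finite Z" using sub fin finite_subset by blast+
    have "card (X \<union> Y) + 1 = card X + card Y" using card_Un_Int[OF finX(1,2)] XY by simp
    moreover have "card (X \<union> Y \<union> Z) + 2 = card (X \<union> Y) + card Z"
    proof -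
      have "(X \<union> Y) \<inter> Z = {a, c}" using YZ ZX by auto
      then show ?thesis using card_Un_Int[of "X \<union> Y" Z] finX abc by simp
    qed
    ultimately have cU: "card (X \<union> Y \<union> Z) + 3 = card X + card Y + card Z" by linarith
    have "induced F A \<inter> induced F B = {}" if AB: "A \<inter> B = {x}" for A B x
    proof (rule ccontr)
      assume "induced F A \<inter> induced F B \<noteq> {}"
      then obtain f where f: "f \<in> F" "f \<subseteq> {x}" using AB by (auto simp: induced_def)
      then have "card f = 2" using F by (auto simp: sparse_def finite_simple_graph_def)
      moreover have "card f \<le> card {x}" using f by (intro card_mono) auto
      ultimately show False by simp
    qed
    note disj = this[OF XY] this[OF YZ] this[OF ZX]
    have "card (induced F X \<union> induced F Y) = card (induced F X) + card (induced F Y)"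
      using disj(1) fin by (intro card_Un_disjoint) auto
    moreover have "card (induced F X \<union> induced F Y \<union> induced F Z)
        = card (induced F X \<union> induced F Y) + card (induced F Z)"
      using disj(2,3) fin by (intro card_Un_disjoint) auto
    moreover have "card (induced F X \<union> induced F Y \<union> induced F Z) \<le> card (induced F (X \<union> Y \<union> Z))"
      using fin by (intro card_mono) (auto simp: induced_def)
    moreover have "2 \<le> card (X \<union> Y \<union> Z)"
    proof -
      have "card {a, b} \<le> card (X \<union> Y \<union> Z)"
        using XY ZX finX by (intro card_mono) auto
      then show ?thesis using abc by simp
    qed
    moreover from this have "card (induced F (X \<union> Y \<union> Z)) + 3 \<le> 2 * card (X \<union> Y \<union> Z)"
      using sub by (intro sparseD[OF F]) auto
    ultimately have "tight F (X \<union> Y \<union> Z)"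
      using cov cU unfolding cov_def tight_def by linarith
    moreover have "X \<union> Y \<union> Z \<subseteq> V - {v}" using sub by simp
    moreover have "a \<in> X \<union> Y \<union> Z" "b \<in> X \<union> Y \<union> Z" "c \<in> X \<union> Y \<union> Z" using cov by (auto simp: cov_def)
    ultimately show False by (meson nocov)
  qed
  then consider "\<forall>X. \<not> cov a b X" | "\<forall>X. \<not> cov b c X" | "\<forall>X. \<not> cov c a X" by metis
  then show ?thesis
  proof cases
    case 1
    show ?thesis by (rule that[of a b c]) (use 1 good[of a b] a b c abc star in \<open>auto simp: F'_def\<close>)
  next
    case 2
    show ?thesis by (rule that[of b c a]) (use 2 good[of b c] a b c abc star in \<open>auto simp: F'_def\<close>)
  next
    case 3
    show ?thesis by (rule that[of c a b]) (use 3 good[of c a] a b c abc star in \<open>auto simp: F'_def\<close>)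
  qed
qed

lemma maximal_sparse_cover:
  assumes G: "finite_simple_graph V E"
  obtains F XX where "F \<subseteq> E" "sparse V F"
    "\<And>X. X \<in> XX \<Longrightarrow> X \<subseteq> V \<and> 2 \<le> card X" "\<And>e. e \<in> E \<Longrightarrow> \<exists>X\<in>XX. e \<subseteq> X"
    "(\<Sum>X\<in>XX. 2 * real (card X) - 3) \<le> real (card F)"
proof -
  have finV: "finite V" and E: "\<And>e. e \<in> E \<Longrightarrow> e \<subseteq> V \<and> card e = 2"
    using G by (auto simp: finite_simple_graph_def)
  have finE: "finite E" using E finV finite_subset[of E "Pow V"] by auto
  have "sparse V {}" using finV by (auto simp: sparse_def finite_simple_graph_def induced_def)
  moreover have "finite {F. F \<subseteq> E \<and> sparse V F}" using finE by simp
  ultimately obtain F where F0: "F \<in> {F. F \<subseteq> E \<and> sparse V F}"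
    and Fmax0: "\<forall>F'\<in>{F. F \<subseteq> E \<and> sparse V F}. F \<subseteq> F' \<longrightarrow> F = F'"
    using finite_has_maximal[of "{F. F \<subseteq> E \<and> sparse V F}"] by auto
  then have F: "F \<subseteq> E" "sparse V F" by simp_all
  have Fmax: "F' = F" if "F' \<subseteq> E" "sparse V F'" "F \<subseteq> F'" for F'
    using Fmax0 that by blast
  have finF: "finite F" using sparse_finite[OF F(2)] by simp
  define TT where "TT = {X. X \<subseteq> V \<and> tight F X}"
  define XX where "XX = {X \<in> TT. \<forall>Y\<in>TT. X \<subseteq> Y \<longrightarrow> Y = X}"
  have finTT: "finite TT" using finV by (simp add: TT_def)
  have finXX: "finite XX" using finTT by (simp add: XX_def)
  have "\<exists>X\<in>XX. e \<subseteq> X" if e: "e \<in> E" for e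
  proof -
    obtain a b where ab: "e = {a, b}" "a \<noteq> b" "a \<in> V" "b \<in> V"
      using E[OF e] by (auto simp: card_2_iff)
    have "\<exists>X\<in>TT. e \<subseteq> X"
    proof (cases "e \<in> F")
      case True
      \<comment> \<open>An edge of \<open>F\<close> is itself a tight set, with one edge and
        \<open>2 * 2 - 3 = 1\<close>.\<close>
      have "card (induced F e) \<ge> 1" using True finF by (auto simp: Suc_le_eq card_gt_0_iff induced_def)
      moreover have "card (induced F e) + 3 \<le> 2 * card e" using E[OF e] by (intro sparseD[OF F(2)]) auto
      ultimately have "tight F e" using E[OF e] by (simp add: tight_def)
      then show ?thesis using E[OF e] by (auto simp: TT_def)
    next
      case False
      then have "\<not> sparse V (insert e F)" using Fmax[of "insert e F"] e F by blast
      then show ?thesis using sparse_insert_edge[OF F(2) ab(3,4,2)] ab(1) by (auto simp: TT_def)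
    qed
    then obtain X where X: "X \<in> TT" "e \<subseteq> X" by blast
    obtain Y where Y: "Y \<in> TT" "X \<subseteq> Y" "\<forall>Z\<in>TT. Y \<subseteq> Z \<longrightarrow> Y = Z"
      using finite_has_maximal2[OF finTT X(1)] by auto
    then have "Y \<in> XX" unfolding XX_def by blast
    then show ?thesis using X Y by blast
  qed
  moreover have "X \<subseteq> V \<and> 2 \<le> card X" if "X \<in> XX" for X
    using that by (auto simp: XX_def TT_def tight_def)
  moreover have "(\<Sum>X\<in>XX. 2 * real (card X) - 3) \<le> real (card F)"
  proof -
    have "(\<Sum>X\<in>XX. 2 * real (card X) - 3) = (\<Sum>X\<in>XX. real (card (induced F X)))"
    proof (rule sum.cong)
      fix X assume "X \<in> XX"
      then have "card (induced F X) + 3 = 2 * card X" by (auto simp: XX_def TT_def tight_def)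
      then show "2 * real (card X) - 3 = real (card (induced F X))" by linarith
    qed simp
    also have "\<dots> = real (\<Sum>X\<in>XX. card (induced F X))" by simp
    also have "(\<Sum>X\<in>XX. card (induced F X)) = card (\<Union>X\<in>XX. induced F X)"
    proof (rule card_UN_disjoint[symmetric])
      show "\<forall>X\<in>XX. \<forall>Y\<in>XX. X \<noteq> Y \<longrightarrow> induced F X \<inter> induced F Y = {}"
      proof (intro ballI impI, rule ccontr)
        fix X Y assume XY: "X \<in> XX" "Y \<in> XX" "X \<noteq> Y" "induced F X \<inter> induced F Y \<noteq> {}"
        then obtain e where e: "e \<in> F" "e \<subseteq> X \<inter> Y" by (auto simp: induced_def)
        have XYT: "X \<in> TT" "Y \<in> TT" using XY by (auto simp: XX_def)
        then have "finite (X \<inter> Y)" using finV finite_subset by (auto simp: TT_def)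
        then have "card e \<le> card (X \<inter> Y)" using e by (intro card_mono)
        then have "2 \<le> card (X \<inter> Y)" using E e F(1) by auto
        then have "X \<union> Y \<in> TT" using tight_Un[OF F(2)] XYT by (auto simp: TT_def)
        then show False using XY by (auto simp: XX_def)
      qed
    qed (use finXX finF in auto)
    also have "card (\<Union>X\<in>XX. induced F X) \<le> card F"
      using finF by (intro card_mono) (auto simp: induced_def)
    finally show ?thesis by simp
  qed
  ultimately show ?thesis using that F by blast
qed

section \<open>Polynomial functions and algebraic independence\<close>

definition eval_monomial :: "('i \<Rightarrow>\<^sub>0 nat) \<Rightarrow> ('i \<Rightarrow> real) \<Rightarrow> real" where
  "eval_monomial m x = (\<Prod>i \<in> Poly_Mapping.keys m. x i ^ Poly_Mapping.lookup m i)"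

definition vars_in :: "'i set \<Rightarrow> (('i \<Rightarrow>\<^sub>0 nat) \<Rightarrow>\<^sub>0 rat) \<Rightarrow> bool" where
  "vars_in I P \<longleftrightarrow> (\<forall>m \<in> Poly_Mapping.keys P. Poly_Mapping.keys m \<subseteq> I)"

lemma eval_monomial_superset:
  assumes "finite K" "Poly_Mapping.keys m \<subseteq> K"
  shows "eval_monomial m x = (\<Prod>i \<in> K. x i ^ Poly_Mapping.lookup m i)"
  unfolding eval_monomial_def
  by (rule prod.mono_neutral_left) (use assms in \<open>auto simp: in_keys_iff\<close>)

lemma eval_monomial_0 [simp]: "eval_monomial 0 x = 1"
  by (simp add: eval_monomial_def)

lemma eval_monomial_add: "eval_monomial (m + n) x = eval_monomial m x * eval_monomial n x"
proof -
  let ?K = "Poly_Mapping.keys m \<union> Poly_Mapping.keys n"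
  have "eval_monomial (m + n) x = (\<Prod>i\<in>?K. x i ^ Poly_Mapping.lookup (m + n) i)"
    using keys_add[of m n] by (intro eval_monomial_superset) auto
  also have "\<dots> = (\<Prod>i\<in>?K. x i ^ Poly_Mapping.lookup m i) * (\<Prod>i\<in>?K. x i ^ Poly_Mapping.lookup n i)"
    by (simp add: lookup_add power_add prod.distrib)
  also have "(\<Prod>i\<in>?K. x i ^ Poly_Mapping.lookup m i) = eval_monomial m x"
    by (rule eval_monomial_superset[symmetric]) auto
  also have "(\<Prod>i\<in>?K. x i ^ Poly_Mapping.lookup n i) = eval_monomial n x"
    by (rule eval_monomial_superset[symmetric]) auto
  finally show ?thesis .
qed

lemma eval_rat_mpoly_superset:
  assumes "finite K" "Poly_Mapping.keys P \<subseteq> K"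
  shows "eval_rat_mpoly P x = (\<Sum>m\<in>K. of_rat (Poly_Mapping.lookup P m) * eval_monomial m x)"
  unfolding eval_rat_mpoly_def eval_monomial_def[symmetric]
  by (rule sum.mono_neutral_left) (use assms in \<open>auto simp: in_keys_iff\<close>)

lemma eval_rat_mpoly_0 [simp]: "eval_rat_mpoly 0 x = 0"
  by (simp add: eval_rat_mpoly_def)

lemma eval_rat_mpoly_single [simp]: "eval_rat_mpoly (Poly_Mapping.single m c) x = of_rat c * eval_monomial m x"
  by (subst eval_rat_mpoly_superset[of "{m}"]) auto

lemma eval_rat_mpoly_add: "eval_rat_mpoly (P + Q) x = eval_rat_mpoly P x + eval_rat_mpoly Q x"
proof -
  let ?K = "Poly_Mapping.keys P \<union> Poly_Mapping.keys Q"
  have "eval_rat_mpoly (P + Q) x = (\<Sum>m\<in>?K. of_rat (Poly_Mapping.lookup (P + Q) m) * eval_monomial m x)"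
    using keys_add[of P Q] by (intro eval_rat_mpoly_superset) auto
  also have "\<dots> = (\<Sum>m\<in>?K. of_rat (Poly_Mapping.lookup P m) * eval_monomial m x)
      + (\<Sum>m\<in>?K. of_rat (Poly_Mapping.lookup Q m) * eval_monomial m x)"
    by (simp add: lookup_add of_rat_add ring_distribs sum.distrib)
  also have "(\<Sum>m\<in>?K. of_rat (Poly_Mapping.lookup P m) * eval_monomial m x) = eval_rat_mpoly P x"
    by (rule eval_rat_mpoly_superset[symmetric]) auto
  also have "(\<Sum>m\<in>?K. of_rat (Poly_Mapping.lookup Q m) * eval_monomial m x) = eval_rat_mpoly Q x"
    by (rule eval_rat_mpoly_superset[symmetric]) auto
  finally show ?thesis .
qed

lemma eval_rat_mpoly_sum: "eval_rat_mpoly (sum f A) x = (\<Sum>a\<in>A. eval_rat_mpoly (f a) x)"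
  by (induction A rule: infinite_finite_induct) (simp_all add: eval_rat_mpoly_add)

text \<open>Reduces products of polynomials to products of single terms.\<close>

lemma poly_mapping_sum_single:
  fixes P :: "'a \<Rightarrow>\<^sub>0 'b::comm_monoid_add"
  shows "P = (\<Sum>m\<in>Poly_Mapping.keys P. Poly_Mapping.single m (Poly_Mapping.lookup P m))"
proof (rule poly_mapping_eqI)
  fix k
  have "(\<Sum>m\<in>Poly_Mapping.keys P. Poly_Mapping.lookup (Poly_Mapping.single m (Poly_Mapping.lookup P m)) k)
      = (\<Sum>m\<in>Poly_Mapping.keys P. if k = m then Poly_Mapping.lookup P m else 0)"
    by (rule sum.cong) (auto simp: lookup_single when_def)
  then show "Poly_Mapping.lookup P k
      = Poly_Mapping.lookup (\<Sum>m\<in>Poly_Mapping.keys P. Poly_Mapping.single m (Poly_Mapping.lookup P m)) k"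
    by (simp add: lookup_sum in_keys_iff)
qed

lemma eval_rat_mpoly_mult: "eval_rat_mpoly (P * Q) x = eval_rat_mpoly P x * eval_rat_mpoly Q x"
proof -
  let ?s = "\<lambda>P m. Poly_Mapping.single m (Poly_Mapping.lookup P m)"
  have "P * Q = (\<Sum>m\<in>Poly_Mapping.keys P. ?s P m) * (\<Sum>n\<in>Poly_Mapping.keys Q. ?s Q n)"
    by (simp flip: poly_mapping_sum_single)
  also have "\<dots> = (\<Sum>m\<in>Poly_Mapping.keys P. \<Sum>n\<in>Poly_Mapping.keys Q. ?s P m * ?s Q n)"
    by (rule sum_product)
  finally have PQ: "P * Q = (\<Sum>m\<in>Poly_Mapping.keys P. \<Sum>n\<in>Poly_Mapping.keys Q. ?s P m * ?s Q n)" .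
  have "eval_rat_mpoly (P * Q) x = (\<Sum>m\<in>Poly_Mapping.keys P. \<Sum>n\<in>Poly_Mapping.keys Q.
      (of_rat (Poly_Mapping.lookup P m) * eval_monomial m x) * (of_rat (Poly_Mapping.lookup Q n) * eval_monomial n x))"
    by (subst PQ) (simp add: eval_rat_mpoly_sum mult_single of_rat_mult eval_monomial_add mult_ac)
  also have "\<dots> = eval_rat_mpoly P x * eval_rat_mpoly Q x"
    by (simp only: sum_product[symmetric] eval_rat_mpoly_def eval_monomial_def)
  finally show ?thesis .
qed

text \<open>Closure under ring operations makes determinants recognisable as rational polynomials
  without writing these down.\<close>

definition polyfun :: "'i set \<Rightarrow> (('i \<Rightarrow> real) \<Rightarrow> real) \<Rightarrow> bool" where
  "polyfun I f \<longleftrightarrow> (\<exists>P. vars_in I P \<and> (\<forall>x. f x = eval_rat_mpoly P x))"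

lemma polyfun_const: "polyfun I (\<lambda>_. of_rat c)"
  unfolding polyfun_def
  by (rule exI[of _ "Poly_Mapping.single 0 c"]) (auto simp: vars_in_def)

lemma polyfun_of_int: "polyfun I (\<lambda>_. of_int c)"
  using polyfun_const[of I "of_int c"] by simp

lemma polyfun_var: "i \<in> I \<Longrightarrow> polyfun I (\<lambda>x. x i)"
  unfolding polyfun_def
  by (rule exI[of _ "Poly_Mapping.single (Poly_Mapping.single i 1) 1"])
    (auto simp: vars_in_def eval_monomial_def)

lemma polyfun_add: "polyfun I f \<Longrightarrow> polyfun I g \<Longrightarrow> polyfun I (\<lambda>x. f x + g x)"
  unfolding polyfun_def
proof (elim exE conjE)
  fix P Q assume "vars_in I P" "vars_in I Q" "\<forall>x. f x = eval_rat_mpoly P x" "\<forall>x. g x = eval_rat_mpoly Q x"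
  moreover from this have "vars_in I (P + Q)" using keys_add[of P Q] unfolding vars_in_def by blast
  ultimately show "\<exists>R. vars_in I R \<and> (\<forall>x. f x + g x = eval_rat_mpoly R x)"
    by (intro exI[of _ "P + Q"]) (simp add: eval_rat_mpoly_add)
qed

lemma polyfun_mult: "polyfun I f \<Longrightarrow> polyfun I g \<Longrightarrow> polyfun I (\<lambda>x. f x * g x)"
  unfolding polyfun_def
proof (elim exE conjE)
  fix P Q assume PQ: "vars_in I P" "vars_in I Q" "\<forall>x. f x = eval_rat_mpoly P x" "\<forall>x. g x = eval_rat_mpoly Q x"
  have "vars_in I (P * Q)"
    unfolding vars_in_def
  proof
    fix k assume "k \<in> Poly_Mapping.keys (P * Q)"
    then obtain m n where "k = m + n" "m \<in> Poly_Mapping.keys P" "n \<in> Poly_Mapping.keys Q"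
      using keys_mult[of P Q] by blast
    then show "Poly_Mapping.keys k \<subseteq> I" using PQ(1,2) keys_add[of m n] unfolding vars_in_def by blast
  qed
  then show "\<exists>R. vars_in I R \<and> (\<forall>x. f x * g x = eval_rat_mpoly R x)"
    using PQ by (intro exI[of _ "P * Q"]) (auto simp: eval_rat_mpoly_mult)
qed

lemma polyfun_diff: "polyfun I f \<Longrightarrow> polyfun I g \<Longrightarrow> polyfun I (\<lambda>x. f x - g x)"
  using polyfun_add[of I f "\<lambda>x. of_int (-1) * g x"] polyfun_mult[OF polyfun_of_int[of I "-1"], of g] by simp

lemma polyfun_sum: "(\<And>a. a \<in> A \<Longrightarrow> polyfun I (f a)) \<Longrightarrow> polyfun I (\<lambda>x. \<Sum>a\<in>A. f a x)"
  by (induction A rule: infinite_finite_induct) (use polyfun_of_int[of I 0] in \<open>auto intro: polyfun_add\<close>)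

lemma polyfun_prod: "(\<And>a. a \<in> A \<Longrightarrow> polyfun I (f a)) \<Longrightarrow> polyfun I (\<lambda>x. \<Prod>a\<in>A. f a x)"
  by (induction A rule: infinite_finite_induct) (use polyfun_of_int[of I 1] in \<open>auto intro: polyfun_mult\<close>)

text \<open>A nonzero value at any point shows that the polynomial behind \<open>f\<close> is not
  zero. This transfers nondegeneracy from a test point \<open>y\<close> to the generic
  point.\<close>

lemma alg_independent_polyfun_nonzero:
  assumes "alg_independent_over_rat I x" "polyfun I f" "f y \<noteq> 0"
  shows "f x \<noteq> 0"
proof -
  obtain P where P: "vars_in I P" "\<And>x. f x = eval_rat_mpoly P x"
    using assms(2) unfolding polyfun_def by blast
  have "P \<noteq> 0" using P(2)[of y] assms(3) by auto
  then show ?thesis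
    using assms(1) P unfolding alg_independent_over_rat_def vars_in_def by metis
qed

section \<open>Existence of algebraically independent families\<close>

lemma countable_poly_mapping:
  assumes "countable A"
  shows "countable {P :: 'a \<Rightarrow>\<^sub>0 'b::{zero, countable}. Poly_Mapping.keys P \<subseteq> A}"
proof (rule countable_image_inj_on)
  let ?S = "{P :: 'a \<Rightarrow>\<^sub>0 'b. Poly_Mapping.keys P \<subseteq> A}"
  \<comment> \<open>A finitely supported map is determined by the finite graph of its nonzero
    values.\<close>
  let ?g = "\<lambda>P :: 'a \<Rightarrow>\<^sub>0 'b. (\<lambda>k. (k, Poly_Mapping.lookup P k)) ` Poly_Mapping.keys P"
  have "?g ` ?S \<subseteq> {B. finite B \<and> B \<subseteq> A \<times> UNIV}" by auto
  moreover have "countable {B. finite B \<and> B \<subseteq> A \<times> (UNIV :: 'b set)}"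
    using assms by (intro countable_Collect_finite_subset countable_SIGMA) auto
  ultimately show "countable (?g ` ?S)" by (rule countable_subset)
  show "inj_on ?g ?S"
  proof (rule inj_onI, rule poly_mapping_eqI)
    fix P Q :: "'a \<Rightarrow>\<^sub>0 'b" and k
    assume PQ: "?g P = ?g Q"
    have "k \<in> Poly_Mapping.keys P \<longleftrightarrow> k \<in> Poly_Mapping.keys Q"
      using arg_cong[OF PQ, of "\<lambda>B. fst ` B"] by (simp add: image_image)
    moreover have "(k, Poly_Mapping.lookup P k) \<in> ?g Q" if "k \<in> Poly_Mapping.keys P"
      using that PQ by blast
    ultimately show "Poly_Mapping.lookup P k = Poly_Mapping.lookup Q k"
      by (cases "k \<in> Poly_Mapping.keys P") (auto simp: in_keys_iff)
  qed
qed

lemma countable_rat_mpoly: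
  assumes "countable I" shows "countable {P. vars_in I P}"
proof -
  have "countable {P :: ('a \<Rightarrow>\<^sub>0 nat) \<Rightarrow>\<^sub>0 rat. Poly_Mapping.keys P \<subseteq> {m. Poly_Mapping.keys m \<subseteq> I}}"
    by (intro countable_poly_mapping assms)
  then show ?thesis by (simp add: vars_in_def subset_iff Ball_def)
qed

lemma eval_monomial_upd:
  "eval_monomial m (x(i := t)) = eval_monomial (Poly_Mapping.update i 0 m) x * t ^ Poly_Mapping.lookup m i"
proof -
  let ?K = "Poly_Mapping.keys m"
  have "eval_monomial m (x(i := t)) = (\<Prod>j\<in>insert i ?K. (x(i := t)) j ^ Poly_Mapping.lookup m j)"
    by (rule eval_monomial_superset) auto
  also have "\<dots> = t ^ Poly_Mapping.lookup m i * (\<Prod>j\<in>?K - {i}. (x(i := t)) j ^ Poly_Mapping.lookup m j)"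
    by (subst prod.insert_remove) auto
  also have "(\<Prod>j\<in>?K - {i}. (x(i := t)) j ^ Poly_Mapping.lookup m j) = eval_monomial (Poly_Mapping.update i 0 m) x"
    unfolding eval_monomial_def by (rule prod.cong) (auto simp: keys_update lookup_update)
  finally show ?thesis by (simp only: mult.commute)
qed

text \<open>Along the coordinate \<open>i\<close>, \<open>P\<close> becomes a univariate polynomial
  \<open>q\<close> in \<open>t\<close>. One of its coefficients is the value at \<open>x\<close> of
  a nonzero rational polynomial with variables in \<open>I\<close>, hence nonzero by independence,
  so \<open>q\<close> has finitely many roots.\<close>

lemma finite_zeros_alg_independent:
  assumes x: "alg_independent_over_rat I x" and P: "vars_in (insert i I) P" "P \<noteq> 0"
  shows "finite {t. eval_rat_mpoly P (x(i := t)) = 0}"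
proof -
  define z where "z m = Poly_Mapping.update i (0::nat) m" for m
  define a where "a m = of_rat (Poly_Mapping.lookup P m) * eval_monomial (z m) x" for m
  define q where "q = (\<Sum>m\<in>Poly_Mapping.keys P. monom (a m) (Poly_Mapping.lookup m i))"
  have eq: "eval_rat_mpoly P (x(i := t)) = poly q t" for t
    unfolding eval_rat_mpoly_def eval_monomial_def[symmetric] q_def a_def z_def eval_monomial_upd
    by (simp add: poly_sum poly_monom mult_ac)
  obtain m0 where m0: "m0 \<in> Poly_Mapping.keys P" using P(2) by (metis keys_eq_empty all_not_in_conv)
  \<comment> \<open>\<open>k\<close> is an exponent of \<open>i\<close> that occurs, and
    \<open>R\<close> is the coefficient of \<open>t ^ k\<close>. Nothing cancels in
    \<open>R\<close>: monomials with the same exponent of \<open>i\<close> stay distinct when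
    \<open>z\<close> removes that variable.\<close>
  define k where "k = Poly_Mapping.lookup m0 i"
  define M where "M = {m \<in> Poly_Mapping.keys P. Poly_Mapping.lookup m i = k}"
  define R where "R = (\<Sum>m\<in>M. Poly_Mapping.single (z m) (Poly_Mapping.lookup P m))"
  have finM: "finite M" by (simp add: M_def)
  have z_inj: "m = m'" if "z m = z m'" "Poly_Mapping.lookup m i = Poly_Mapping.lookup m' i" for m m'
  proof (rule poly_mapping_eqI)
    fix j
    show "Poly_Mapping.lookup m j = Poly_Mapping.lookup m' j"
      using arg_cong[OF that(1), of "\<lambda>p. Poly_Mapping.lookup p j"] that(2)
      by (cases "j = i") (auto simp: z_def lookup_update)
  qed
  have "Poly_Mapping.lookup R (z m0) = (\<Sum>m\<in>M. if m = m0 then Poly_Mapping.lookup P m else 0)"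
    unfolding R_def lookup_sum
  proof (rule sum.cong)
    fix m assume "m \<in> M"
    then have "z m = z m0 \<longleftrightarrow> m = m0" using z_inj[of m m0] by (auto simp: M_def k_def)
    then show "Poly_Mapping.lookup (Poly_Mapping.single (z m) (Poly_Mapping.lookup P m)) (z m0)
        = (if m = m0 then Poly_Mapping.lookup P m else 0)"
      by (auto simp: lookup_single when_def)
  qed simp
  also have "\<dots> = Poly_Mapping.lookup P m0" using m0 finM by (simp add: M_def k_def)
  finally have "R \<noteq> 0" using m0 by (auto simp: in_keys_iff)
  moreover have "vars_in I R"
    unfolding vars_in_def
  proof
    fix m' assume "m' \<in> Poly_Mapping.keys R"
    then obtain m where "m \<in> M" "m' = z m"
      using keys_sum[of "\<lambda>m. Poly_Mapping.single (z m) (Poly_Mapping.lookup P m)" M]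
      by (auto simp: R_def split: if_splits)
    moreover from this have "Poly_Mapping.keys m \<subseteq> insert i I" using P(1) by (auto simp: M_def vars_in_def)
    ultimately show "Poly_Mapping.keys m' \<subseteq> I" by (auto simp: z_def keys_update)
  qed
  ultimately have "eval_rat_mpoly R x \<noteq> 0"
    using x unfolding alg_independent_over_rat_def vars_in_def by blast
  moreover have "coeff q k = eval_rat_mpoly R x"
  proof -
    have "coeff q k = (\<Sum>m\<in>Poly_Mapping.keys P. if Poly_Mapping.lookup m i = k then a m else 0)"
      by (simp add: q_def coeff_sum)
    also have "\<dots> = (\<Sum>m\<in>M. a m)" unfolding M_def by (subst sum.inter_filter) auto
    finally show ?thesis by (simp add: R_def eval_rat_mpoly_sum a_def)
  qed
  ultimately have "q \<noteq> 0" by auto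
  then show ?thesis using poly_roots_finite[of q] by (simp add: eq)
qed

text \<open>Each nonzero polynomial forbids finitely many values of the new coordinate, and there
  are countably many polynomials, so some real number remains.\<close>

lemma alg_independent_exists:
  assumes "finite I" shows "\<exists>x. alg_independent_over_rat I x"
  using assms
proof (induction I)
  case empty
  have "P = 0" if P: "vars_in {} P" "eval_rat_mpoly P (\<lambda>_. 0) = 0" for P :: "('a \<Rightarrow>\<^sub>0 nat) \<Rightarrow>\<^sub>0 rat"
  proof -
    have sub: "Poly_Mapping.keys P \<subseteq> {0}" using P(1) by (auto simp: vars_in_def)
    then have "Poly_Mapping.lookup P 0 = 0" using P(2) eval_rat_mpoly_superset[of "{0}" P] by simp
    then show "P = 0" using sub by (metis in_keys_iff keys_eq_empty subset_singletonD singletonI)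
  qed
  then show ?case unfolding alg_independent_over_rat_def vars_in_def by blast
next
  case (insert i I)
  then obtain x where x: "alg_independent_over_rat I x" by blast
  define B where "B = (\<Union>P\<in>{P. vars_in (insert i I) P} - {0}. {t. eval_rat_mpoly P (x(i := t)) = 0})"
  have "countable B"
    unfolding B_def
  proof (rule countable_UN)
    have "countable (insert i I)" using insert by (simp add: countable_finite)
    then show "countable ({P. vars_in (insert i I) P} - {0})" by (intro countable_Diff countable_rat_mpoly)
    show "countable {t. eval_rat_mpoly P (x(i := t)) = 0}" if "P \<in> {P. vars_in (insert i I) P} - {0}" for P
      using finite_zeros_alg_independent[OF x, of i P] that by (auto intro: countable_finite)
  qed
  then have "B \<noteq> UNIV" using uncountable_UNIV_real by auto
  then obtain t where "t \<notin> B" by blast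
  then have "alg_independent_over_rat (insert i I) (x(i := t))"
    unfolding alg_independent_over_rat_def B_def vars_in_def by blast
  then show ?case by blast
qed

lemma generic_realization_exists:
  assumes "finite V" shows "\<exists>p. generic_realization V p"
proof -
  obtain x where x: "alg_independent_over_rat (V \<times> (UNIV :: bool set)) x"
    using alg_independent_exists[of "V \<times> (UNIV :: bool set)"] assms by auto
  have "(\<lambda>(v, b). if b then snd (x (v, False), x (v, True)) else fst (x (v, False), x (v, True))) = x"
    by (auto simp: fun_eq_iff)
  then show ?thesis using x
    by (intro exI[of _ "\<lambda>v. (x (v, False), x (v, True))"]) (simp add: generic_realization_def)
qed

section \<open>Stresses and Laman's theorem\<close>

text \<open>
  A realization is given by its coordinate family \<open>q\<close>, and a stress \<open>\<omega>\<close> is a function on all sets that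
  vanishes off the edge set; \<open>stress_free\<close> says that the rows of the rigidity matrix are independent.
  The summand for \<open>w = v\<close> is zero.
\<close>

definition equilibrium :: "'v set \<Rightarrow> ('v \<times> bool \<Rightarrow> real) \<Rightarrow> ('v set \<Rightarrow> real) \<Rightarrow> bool" where
  "equilibrium V q \<omega> \<longleftrightarrow> (\<forall>v\<in>V. \<forall>k. (\<Sum>w\<in>V. \<omega> {v, w} * (q (v, k) - q (w, k))) = 0)"

definition stress_free :: "'v set \<Rightarrow> 'v set set \<Rightarrow> ('v \<times> bool \<Rightarrow> real) \<Rightarrow> bool" where
  "stress_free V F q \<longleftrightarrow>
    (\<forall>\<omega>. (\<forall>e. e \<notin> F \<longrightarrow> \<omega> e = 0) \<longrightarrow> equilibrium V q \<omega> \<longrightarrow> (\<forall>e. \<omega> e = 0))"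

text \<open>The sum finds the other end of \<open>e\<close>, so the row is described without
  orienting \<open>e\<close> or enumerating the vertices; it is 0 when \<open>v\<close> is not on
  \<open>e\<close>.\<close>

definition row_entry :: "'v set \<Rightarrow> ('v \<times> bool \<Rightarrow> real) \<Rightarrow> 'v set \<Rightarrow> 'v \<times> bool \<Rightarrow> real" where
  "row_entry V q e = (\<lambda>(v, k). \<Sum>w\<in>V. if {v, w} = e then q (v, k) - q (w, k) else 0)"

section \<open>Gram determinants and linear independence of rows\<close>

definition gram :: "nat \<Rightarrow> 'x set \<Rightarrow> (nat \<Rightarrow> 'x \<Rightarrow> real) \<Rightarrow> real mat" where
  "gram n X A = mat n n (\<lambda>(i, j). \<Sum>x\<in>X. A i x * A j x)"

text \<open>Over the reals the quadratic form of a Gram matrix is a sum of squares, so its kernel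
  consists exactly of the linear dependencies of the rows. This yields a square matrix without a
  choice of columns.\<close>

lemma det_gram_eq_0_iff:
  assumes "finite X"
  shows "det (gram n X A) = 0 \<longleftrightarrow> (\<exists>y. (\<exists>i<n. y i \<noteq> 0) \<and> (\<forall>x\<in>X. (\<Sum>i<n. y i * A i x) = 0))"
proof -
  have G: "gram n X A \<in> carrier_mat n n" by (simp add: gram_def)
  have mv: "(gram n X A *\<^sub>v vec n y) $ i = (\<Sum>x\<in>X. A i x * (\<Sum>j<n. y j * A j x))" if "i < n" for i y
  proof -
    have "(gram n X A *\<^sub>v vec n y) $ i = (\<Sum>j<n. (\<Sum>x\<in>X. A i x * A j x) * y j)"
      using that by (simp add: gram_def scalar_prod_def lessThan_atLeast0)
    also have "\<dots> = (\<Sum>j<n. \<Sum>x\<in>X. A i x * (y j * A j x))"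
      by (simp add: sum_distrib_right sum_distrib_left mult_ac)
    also have "\<dots> = (\<Sum>x\<in>X. \<Sum>j<n. A i x * (y j * A j x))" by (rule sum.swap)
    finally show ?thesis by (simp add: sum_distrib_left)
  qed
  show ?thesis
    unfolding det_0_iff_vec_prod_zero_field[OF G]
  proof
    assume "\<exists>v. v \<in> carrier_vec n \<and> v \<noteq> 0\<^sub>v n \<and> gram n X A *\<^sub>v v = 0\<^sub>v n"
    then obtain v where v: "v \<in> carrier_vec n" "v \<noteq> 0\<^sub>v n" "gram n X A *\<^sub>v v = 0\<^sub>v n" by blast
    define y where "y i = v $ i" for i
    have vy: "v = vec n y" using v(1) by (intro eq_vecI) (auto simp: y_def)
    have "(\<Sum>x\<in>X. A i x * (\<Sum>j<n. y j * A j x)) = 0" if "i < n" for i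
      using mv[OF that, of y] v(3) that by (simp add: vy)
    \<comment> \<open>Pairing the kernel equation with \<open>y\<close> gives the sum of
      squares.\<close>
    then have "0 = (\<Sum>i<n. y i * (\<Sum>x\<in>X. A i x * (\<Sum>j<n. y j * A j x)))" by simp
    also have "\<dots> = (\<Sum>i<n. \<Sum>x\<in>X. y i * A i x * (\<Sum>j<n. y j * A j x))"
      by (simp add: sum_distrib_left mult_ac)
    also have "\<dots> = (\<Sum>x\<in>X. \<Sum>i<n. y i * A i x * (\<Sum>j<n. y j * A j x))" by (rule sum.swap)
    also have "\<dots> = (\<Sum>x\<in>X. (\<Sum>i<n. y i * A i x) * (\<Sum>j<n. y j * A j x))"
      by (simp add: sum_distrib_right)
    finally have sq: "(\<Sum>x\<in>X. (\<Sum>i<n. y i * A i x) * (\<Sum>j<n. y j * A j x)) = 0" by simp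
    have "\<forall>x\<in>X. (\<Sum>i<n. y i * A i x) * (\<Sum>j<n. y j * A j x) = 0"
      using sq by (subst (asm) sum_nonneg_eq_0_iff[OF assms]) auto
    moreover have "\<exists>i<n. y i \<noteq> 0"
    proof (rule ccontr)
      assume "\<not> ?thesis"
      then have "v = 0\<^sub>v n" unfolding vy by (intro eq_vecI) auto
      then show False using v by simp
    qed
    ultimately show "\<exists>y. (\<exists>i<n. y i \<noteq> 0) \<and> (\<forall>x\<in>X. (\<Sum>i<n. y i * A i x) = 0)" by auto
  next
    assume "\<exists>y. (\<exists>i<n. y i \<noteq> 0) \<and> (\<forall>x\<in>X. (\<Sum>i<n. y i * A i x) = 0)"
    then obtain y where y: "\<exists>i<n. y i \<noteq> 0" "\<forall>x\<in>X. (\<Sum>i<n. y i * A i x) = 0" by blast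
    have "vec n y \<noteq> 0\<^sub>v n" using y(1) by (metis index_vec index_zero_vec(1))
    moreover have "gram n X A *\<^sub>v vec n y = 0\<^sub>v n"
    proof (rule eq_vecI)
      show "(gram n X A *\<^sub>v vec n y) $ i = 0\<^sub>v n $ i" if "i < dim_vec (0\<^sub>v n :: real vec)" for i
        using that mv[of i y] y(2) by simp
    qed (simp add: gram_def)
    ultimately show "\<exists>v. v \<in> carrier_vec n \<and> v \<noteq> 0\<^sub>v n \<and> gram n X A *\<^sub>v v = 0\<^sub>v n"
      by (intro exI[of _ "vec n y"]) auto
  qed
qed

lemma sum_stress_row_entry:
  assumes "finite F" "\<And>e. e \<notin> F \<Longrightarrow> \<omega> e = 0"
  shows "(\<Sum>e\<in>F. \<omega> e * row_entry V q e (v, k)) = (\<Sum>w\<in>V. \<omega> {v, w} * (q (v, k) - q (w, k)))"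
proof -
  have "(\<Sum>e\<in>F. \<omega> e * row_entry V q e (v, k))
      = (\<Sum>e\<in>F. \<Sum>w\<in>V. if e = {v, w} then \<omega> e * (q (v, k) - q (w, k)) else 0)"
    unfolding row_entry_def by (auto simp: sum_distrib_left intro!: sum.cong)
  also have "\<dots> = (\<Sum>w\<in>V. \<Sum>e\<in>F. if e = {v, w} then \<omega> e * (q (v, k) - q (w, k)) else 0)"
    by (rule sum.swap)
  also have "\<dots> = (\<Sum>w\<in>V. \<omega> {v, w} * (q (v, k) - q (w, k)))"
    using assms by (intro sum.cong) auto
  finally show ?thesis .
qed

lemma stress_free_iff_det_gram:
  assumes "finite V" and fs: "distinct fs" "set fs = F"
  shows "stress_free V F q \<longleftrightarrow> det (gram (length fs) (V \<times> UNIV) (\<lambda>i. row_entry V q (fs ! i))) \<noteq> 0"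
proof -
  have bij: "bij_betw ((!) fs) {..<length fs} F" using bij_betw_nth[OF fs(1) refl] fs(2) by simp
  have finF: "finite F" using fs by auto
  have sum_fs: "(\<Sum>i<length fs. f (fs ! i)) = sum f F" for f :: "'a set \<Rightarrow> real"
    by (rule sum.reindex_bij_betw[OF bij])
  have eq: "(\<forall>x\<in>V \<times> UNIV. (\<Sum>i<length fs. \<omega> (fs ! i) * row_entry V q (fs ! i) x) = 0) \<longleftrightarrow> equilibrium V q \<omega>"
    if "\<forall>e. e \<notin> F \<longrightarrow> \<omega> e = 0" for \<omega>
    using that finF unfolding equilibrium_def sum_fs[of "\<lambda>e. \<omega> e * row_entry V q e _"]
    by (simp add: Ball_def split_paired_All sum_stress_row_entry)
  have "\<not> stress_free V F q \<longleftrightarrow> (\<exists>y. (\<exists>i<length fs. y i \<noteq> 0) \<and>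
      (\<forall>x\<in>V \<times> UNIV. (\<Sum>i<length fs. y i * row_entry V q (fs ! i) x) = 0))" (is "_ \<longleftrightarrow> ?R")
  proof
    assume "\<not> stress_free V F q"
    then obtain \<omega> e where \<omega>: "\<forall>e. e \<notin> F \<longrightarrow> \<omega> e = 0" "equilibrium V q \<omega>" "\<omega> e \<noteq> 0"
      unfolding stress_free_def by blast
    then have "e \<in> set fs" using fs by auto
    then obtain i where "i < length fs" "fs ! i = e" by (auto simp: in_set_conv_nth)
    then show ?R using \<omega> eq[OF \<omega>(1)] by (intro exI[of _ "\<lambda>i. \<omega> (fs ! i)"]) auto
  next
    assume ?R
    then obtain y where y: "\<exists>i<length fs. y i \<noteq> 0"
      "\<forall>x\<in>V \<times> UNIV. (\<Sum>i<length fs. y i * row_entry V q (fs ! i) x) = 0" by blast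
    define \<omega> where "\<omega> e = (if e \<in> F then y (the_inv_into {..<length fs} ((!) fs) e) else 0)" for e
    have \<omega>: "\<omega> (fs ! i) = y i" if "i < length fs" for i
      using that fs the_inv_into_f_f[OF bij_betw_imp_inj_on[OF bij], of i] by (auto simp: \<omega>_def)
    have s: "\<forall>e. e \<notin> F \<longrightarrow> \<omega> e = 0" by (simp add: \<omega>_def)
    have "equilibrium V q \<omega>" using eq[OF s] y(2) \<omega> by simp
    moreover have "\<exists>e. \<omega> e \<noteq> 0" using y(1) \<omega> by metis
    ultimately show "\<not> stress_free V F q" using s unfolding stress_free_def by blast
  qed
  moreover have fin: "finite (V \<times> (UNIV :: bool set))" using assms(1) by simp
  ultimately show ?thesis unfolding det_gram_eq_0_iff[OF fin] by blast
qed

lemma polyfun_det: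
  assumes "\<And>i j. i < n \<Longrightarrow> j < n \<Longrightarrow> polyfun I (\<lambda>x. M x i j)"
  shows "polyfun I (\<lambda>x. det (mat n n (\<lambda>(i, j). M x i j)))"
proof -
  have "det (mat n n (\<lambda>(i, j). M x i j)) = (\<Sum>\<pi> | \<pi> permutes {0..<n}. of_int (sign \<pi>) * (\<Prod>i = 0..<n. M x i (\<pi> i)))" for x
  proof -
    have "det (mat n n (\<lambda>(i, j). M x i j)) = (\<Sum>\<pi> | \<pi> permutes {0..<n}.
        of_int (sign \<pi>) * (\<Prod>i = 0..<n. mat n n (\<lambda>(i, j). M x i j) $$ (i, \<pi> i)))"
      by (rule det_def') simp
    also have "\<dots> = (\<Sum>\<pi> | \<pi> permutes {0..<n}. of_int (sign \<pi>) * (\<Prod>i = 0..<n. M x i (\<pi> i)))"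
    proof (intro sum.cong refl arg_cong2[where f = "(*)"] prod.cong)
      fix \<pi> i assume "\<pi> \<in> {\<pi>. \<pi> permutes {0..<n}}" "i \<in> {0..<n}"
      then show "mat n n (\<lambda>(i, j). M x i j) $$ (i, \<pi> i) = M x i (\<pi> i)"
        using permutes_in_image[of \<pi> "{0..<n}" i] by simp
    qed
    finally show ?thesis .
  qed
  moreover have "polyfun I (\<lambda>x. \<Sum>\<pi> | \<pi> permutes {0..<n}. of_int (sign \<pi>) * (\<Prod>i = 0..<n. M x i (\<pi> i)))"
  proof (intro polyfun_sum polyfun_mult polyfun_prod polyfun_of_int assms)
    fix \<pi> i assume "\<pi> \<in> {\<pi>. \<pi> permutes {0..<n}}" "i \<in> {0..<n}"
    then show "\<pi> i < n" using permutes_in_image[of \<pi> "{0..<n}" i] by simp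
  qed simp
  ultimately show ?thesis by simp
qed

lemma polyfun_row_entry:
  assumes "x \<in> V \<times> UNIV" shows "polyfun (V \<times> UNIV) (\<lambda>q. row_entry V q e x)"
proof -
  obtain v k where x: "x = (v, k)" "v \<in> V" using assms by auto
  have "polyfun (V \<times> UNIV) (\<lambda>q. if {v, w} = e then q (v, k) - q (w, k) else 0)" if "w \<in> V" for w
    using that x polyfun_of_int[of "V \<times> UNIV" 0]
    by (cases "{v, w} = e") (auto intro!: polyfun_diff polyfun_var)
  then show ?thesis unfolding x row_entry_def by (auto intro!: polyfun_sum)
qed

text \<open>
  The Gram determinant turns independence of the rows into the nonvanishing of one polynomial with
  rational coefficients, so that a single special position suffices.
\<close>

lemma stress_free_generic:
  assumes "finite V" "finite F" and free: "stress_free V F q0"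
    and q: "alg_independent_over_rat (V \<times> UNIV) q"
  shows "stress_free V F q"
proof -
  obtain fs where fs: "distinct fs" "set fs = F" using finite_distinct_list[OF assms(2)] by blast
  let ?f = "\<lambda>q. det (gram (length fs) (V \<times> UNIV) (\<lambda>i. row_entry V q (fs ! i)))"
  have "polyfun (V \<times> UNIV) ?f"
    unfolding gram_def
    by (intro polyfun_det polyfun_sum polyfun_mult polyfun_row_entry)
  moreover have "?f q0 \<noteq> 0" using free stress_free_iff_det_gram[OF assms(1) fs] by blast
  ultimately have "?f q \<noteq> 0" using alg_independent_polyfun_nonzero[OF q, of ?f q0] by blast
  then show ?thesis using stress_free_iff_det_gram[OF assms(1) fs] by blast
qed

section \<open>Extending a stress-free graph by one vertex\<close>

lemma equilibrium_delete:
  assumes "finite V" "v \<in> V" "equilibrium V q \<omega>" "u \<in> V - {v}"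
  shows "(\<Sum>w\<in>V - {v}. \<omega> {u, w} * (q (u, k) - q (w, k))) = \<omega> {v, u} * (q (v, k) - q (u, k))"
proof -
  have "(\<Sum>w\<in>V. \<omega> {u, w} * (q (u, k) - q (w, k))) = 0" using assms by (auto simp: equilibrium_def)
  then have "\<omega> {u, v} * (q (u, k) - q (v, k)) + (\<Sum>w\<in>V - {v}. \<omega> {u, w} * (q (u, k) - q (w, k))) = 0"
    using sum.remove[OF assms(1,2), of "\<lambda>w. \<omega> {u, w} * (q (u, k) - q (w, k))"] by simp
  then show ?thesis by (simp add: insert_commute algebra_simps)
qed

text \<open>Lets the new vertex be moved freely: the smaller graph does not see its
  position.\<close>

lemma stress_free_cong:
  assumes "stress_free V F q" "\<And>v k. v \<in> V \<Longrightarrow> q (v, k) = q' (v, k)"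
  shows "stress_free V F q'"
proof -
  have "equilibrium V q' \<omega> = equilibrium V q \<omega>" for \<omega>
    unfolding equilibrium_def using assms(2) by (intro ball_cong all_cong1 arg_cong2[where f = "(=)"] sum.cong) auto
  then show ?thesis using assms(1) by (simp add: stress_free_def)
qed

text \<open>\<open>zero\<close> is a condition at \<open>v\<close> alone: balance there already
  kills the stress on the edges at \<open>v\<close>, and what is left is a stress of the smaller
  graph.\<close>

lemma stress_free_0_extension:
  assumes "finite V" "v \<in> V" and free: "stress_free (V - {v}) {e \<in> F. v \<notin> e} q"
    and zero: "\<And>\<omega>. (\<And>e. e \<notin> F \<Longrightarrow> \<omega> e = 0) \<Longrightarrow> (\<And>k. (\<Sum>w\<in>V. \<omega> {v, w} * (q (v, k) - q (w, k))) = 0) \<Longrightarrow>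
      \<forall>e\<in>F. v \<in> e \<longrightarrow> \<omega> e = 0"
  shows "stress_free V F q"
  unfolding stress_free_def
proof (intro allI impI)
  fix \<omega> e assume supp: "\<forall>e. e \<notin> F \<longrightarrow> \<omega> e = 0" and eq: "equilibrium V q \<omega>"
  have "\<forall>e\<in>F. v \<in> e \<longrightarrow> \<omega> e = 0"
    using eq assms(2) supp by (intro zero) (auto simp: equilibrium_def)
  then have star: "\<omega> e = 0" if "v \<in> e" for e using supp that by blast
  have "equilibrium (V - {v}) q \<omega>"
    unfolding equilibrium_def using equilibrium_delete[OF assms(1,2) eq] star by simp
  moreover have "\<forall>e. e \<notin> {e \<in> F. v \<notin> e} \<longrightarrow> \<omega> e = 0" using supp star by auto
  ultimately show "\<omega> e = 0" using free unfolding stress_free_def by blast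
qed

lemma generic_first_coordinates_differ:
  assumes "alg_independent_over_rat (V \<times> (UNIV :: bool set)) q" "a \<in> V" "b \<in> V" "a \<noteq> b"
  shows "q (a, False) \<noteq> q (b, False)"
proof -
  have "polyfun (V \<times> (UNIV :: bool set)) (\<lambda>q. q (a, False) - q (b, False))"
    using assms by (intro polyfun_diff polyfun_var) auto
  from alg_independent_polyfun_nonzero[OF assms(1) this, of "\<lambda>x. if x = (a, False) then 1 else 0"]
  show ?thesis using assms(4) by auto
qed

text \<open>Twice the signed area of the triangle, hence nonzero exactly when the three points are
  not collinear.\<close>

definition area :: "('v \<times> bool \<Rightarrow> real) \<Rightarrow> 'v \<Rightarrow> 'v \<Rightarrow> 'v \<Rightarrow> real" where
  "area q a b c = (q (b, False) - q (a, False)) * (q (c, True) - q (a, True))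
    - (q (b, True) - q (a, True)) * (q (c, False) - q (a, False))"

lemma generic_not_collinear:
  assumes "alg_independent_over_rat (V \<times> (UNIV :: bool set)) q" "a \<in> V" "b \<in> V" "c \<in> V" "a \<noteq> b" "a \<noteq> c" "b \<noteq> c"
  shows "area q a b c \<noteq> 0"
proof -
  have "polyfun (V \<times> (UNIV :: bool set)) (\<lambda>q. area q a b c)"
    unfolding area_def using assms by (intro polyfun_diff polyfun_mult polyfun_var) auto
  \<comment> \<open>The test position has \<open>a\<close> at the origin, \<open>b\<close> at
    \<open>(1, 0)\<close> and \<open>c\<close> at \<open>(0, 1)\<close>.\<close>
  from alg_independent_polyfun_nonzero[OF assms(1) this, of "\<lambda>x. if x = (b, False) \<or> x = (c, True) then 1 else 0"]
  show ?thesis using assms(5-7) by (auto simp: area_def)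
qed

text \<open>
  With the new vertex at the midpoint of \<open>a\<close> and \<open>b\<close>, equal stresses on its two edges act on \<open>a\<close> and \<open>b\<close>
  like a stress of half the size on the edge \<open>{a, b}\<close>.
\<close>

lemma stress_free_1_extension:
  assumes "finite V" and v: "v \<in> V" and abc: "a \<in> V - {v}" "b \<in> V - {v}" "c \<in> V - {v}" "a \<noteq> b" "a \<noteq> c" "b \<noteq> c"
    and star: "{e \<in> F. v \<in> e} = {{v, a}, {v, b}, {v, c}}" and ab: "{a, b} \<notin> F"
    and free: "stress_free (V - {v}) (insert {a, b} {e \<in> F. v \<notin> e}) q"
    and area: "area q a b c \<noteq> 0"
    and mid: "\<And>k. q (v, k) = (q (a, k) + q (b, k)) / 2"
  shows "stress_free V F q"
  unfolding stress_free_def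
proof (intro allI impI)
  fix \<omega> e assume supp: "\<forall>e. e \<notin> F \<longrightarrow> \<omega> e = 0" and eq: "equilibrium V q \<omega>"
  have zero_other: "\<omega> {v, w} = 0" if "w \<notin> {a, b, c}" for w
  proof (rule ccontr)
    assume "\<omega> {v, w} \<noteq> 0"
    then have "{v, w} \<in> F" using supp by blast
    then have "{v, w} \<in> {{v, a}, {v, b}, {v, c}}" unfolding star[symmetric] by simp
    then show False using that abc by (auto simp: doubleton_eq_iff)
  qed
  have "\<omega> {v, a} * (q (v, k) - q (a, k)) + \<omega> {v, b} * (q (v, k) - q (b, k)) + \<omega> {v, c} * (q (v, k) - q (c, k)) = 0" for k
  proof -
    have "0 = (\<Sum>w\<in>V. \<omega> {v, w} * (q (v, k) - q (w, k)))" using eq v by (simp add: equilibrium_def)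
    also have "\<dots> = (\<Sum>w\<in>{a, b, c}. \<omega> {v, w} * (q (v, k) - q (w, k)))"
      using assms(1) abc zero_other by (intro sum.mono_neutral_right) auto
    finally show ?thesis using abc by (simp add: add.assoc)
  qed
  note eqv = this
  \<comment> \<open>Twice the balance at the midpoint, written in terms of \<open>b - a\<close> and
    \<open>a + b - 2 * c\<close>.\<close>
  have lin: "(\<omega> {v, a} - \<omega> {v, b}) * (q (b, k) - q (a, k)) + \<omega> {v, c} * (q (a, k) + q (b, k) - 2 * q (c, k)) = 0" for k
    using eqv[of k] by (simp add: mid field_simps)
  define L where "L k = (\<omega> {v, a} - \<omega> {v, b}) * (q (b, k) - q (a, k)) + \<omega> {v, c} * (q (a, k) + q (b, k) - 2 * q (c, k))" for k
  have L0: "L k = 0" for k using lin by (simp add: L_def)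
  \<comment> \<open>Since \<open>a + b - 2 * c = (b - a) - 2 * (c - a)\<close>, the cross product
    with \<open>b - a\<close> leaves only a multiple of the area.\<close>
  have "- 2 * (\<omega> {v, c} * area q a b c) = L True * (q (b, False) - q (a, False)) - L False * (q (b, True) - q (a, True))"
    by (simp add: L_def area_def algebra_simps)
  then have "\<omega> {v, c} * area q a b c = 0" by (simp add: L0)
  then have c0: "\<omega> {v, c} = 0" using area by simp
  have "(\<omega> {v, a} - \<omega> {v, b}) * area q a b c = L False * (q (c, True) - q (a, True)) - L True * (q (c, False) - q (a, False))"
    by (simp add: L_def c0 area_def algebra_simps)
  then have "(\<omega> {v, a} - \<omega> {v, b}) * area q a b c = 0" by (simp add: L0)
  then have vab: "\<omega> {v, b} = \<omega> {v, a}" using area by simp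
  define s where "s = \<omega> {v, a}"
  \<comment> \<open>As \<open>{a, b}\<close> is not in \<open>F\<close>, the value placed on it
    below does not overwrite a stress.\<close>
  have wab: "\<omega> {a, b} = 0" using supp ab by blast
  define \<omega>' where "\<omega>' e = (if e = {a, b} then s / 2 else if v \<in> e then 0 else \<omega> e)" for e
  have "equilibrium (V - {v}) q \<omega>'"
    unfolding equilibrium_def
  proof (intro ballI allI)
    fix u k assume u: "u \<in> V - {v}"
    have "(\<Sum>w\<in>V - {v}. \<omega>' {u, w} * (q (u, k) - q (w, k)))
        = (\<Sum>w\<in>V - {v}. \<omega> {u, w} * (q (u, k) - q (w, k)) + (if {u, w} = {a, b} then s / 2 * (q (u, k) - q (w, k)) else 0))"
    proof (rule sum.cong)
      fix w assume "w \<in> V - {v}"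
      then have "v \<notin> {u, w}" using u by auto
      then have "\<omega>' {u, w} = \<omega> {u, w} + (if {u, w} = {a, b} then s / 2 else 0)" by (simp add: \<omega>'_def wab)
      then show "\<omega>' {u, w} * (q (u, k) - q (w, k)) = \<omega> {u, w} * (q (u, k) - q (w, k))
          + (if {u, w} = {a, b} then s / 2 * (q (u, k) - q (w, k)) else 0)"
        by (simp add: distrib_right)
    qed simp
    also have "\<dots> = \<omega> {v, u} * (q (v, k) - q (u, k))
        + (\<Sum>w\<in>V - {v}. if {u, w} = {a, b} then s / 2 * (q (u, k) - q (w, k)) else 0)"
      unfolding sum.distrib using equilibrium_delete[OF assms(1) v eq u] by simp
    also have "\<dots> = 0"
    proof -
      have fin: "finite (V - {v})" using assms(1) by simp
      consider "u = a" | "u = b" | "u = c" | "u \<notin> {a, b, c}" by blast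
      then show ?thesis
      proof cases
        case 1
        then have "{u, w} = {a, b} \<longleftrightarrow> w = b" for w using abc by (auto simp: doubleton_eq_iff)
        then show ?thesis using fin abc by (simp add: 1 mid s_def field_simps)
      next
        case 2
        then have "{u, w} = {a, b} \<longleftrightarrow> w = a" for w using abc by (auto simp: doubleton_eq_iff)
        then show ?thesis using fin abc by (simp add: 2 mid s_def vab field_simps)
      next
        case 3
        then have "{u, w} \<noteq> {a, b}" for w using abc by (auto simp: doubleton_eq_iff)
        then show ?thesis by (simp add: 3 c0)
      next
        case 4
        then have "{u, w} \<noteq> {a, b}" for w by (auto simp: doubleton_eq_iff)
        then show ?thesis using zero_other[OF 4] by simp
      qed
    qed
    finally show "(\<Sum>w\<in>V - {v}. \<omega>' {u, w} * (q (u, k) - q (w, k))) = 0" .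
  qed
  moreover have "\<forall>e. e \<notin> insert {a, b} {e \<in> F. v \<notin> e} \<longrightarrow> \<omega>' e = 0" using supp by (auto simp: \<omega>'_def)
  ultimately have all0: "\<omega>' e = 0" for e using free unfolding stress_free_def by blast
  have s0: "s = 0" using all0[of "{a, b}"] by (simp add: \<omega>'_def)
  show "\<omega> e = 0"
  proof (cases "v \<in> e")
    case True
    show ?thesis
    proof (rule ccontr)
      assume "\<omega> e \<noteq> 0"
      then have "e \<in> {e \<in> F. v \<in> e}" using supp True by blast
      then show False unfolding star using c0 vab s0 \<open>\<omega> e \<noteq> 0\<close> by (auto simp: s_def)
    qed
  next
    case False
    then show ?thesis using all0[of e] wab by (auto simp: \<omega>'_def split: if_splits)
  qed
qed

lemma sparse_imp_stress_free:
  assumes "sparse V F" "alg_independent_over_rat (V \<times> UNIV) q"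
  shows "stress_free V F q"
  using assms
proof (induction "card V" arbitrary: V F q)
  case 0
  then have "V = {}" using sparse_finite[OF 0(2)] by simp
  then have "F = {}" using 0(2) unfolding sparse_def finite_simple_graph_def
    by (metis card.empty equals0I subset_empty zero_neq_numeral)
  then show ?case by (simp add: stress_free_def)
next
  case (Suc n)
  have fin: "finite V" "finite F" using sparse_finite[OF Suc(3)] .
  have "V \<noteq> {}" using Suc(2) by auto
  then obtain v where v: "v \<in> V" "card {e \<in> F. v \<in> e} \<le> 3" using sparse_low_degree_vertex[OF Suc(3)] by blast
  let ?V = "V - {v}" and ?F = "{e \<in> F. v \<notin> e}"
  have cV: "n = card ?V" using Suc(2) v fin by simp
  \<comment> \<open>An auxiliary generic position of the smaller graph, unrelated to
    \<open>q\<close>: one stress-free position suffices, and in it \<open>v\<close> may be placed at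
    will.\<close>
  obtain r where r: "alg_independent_over_rat (?V \<times> (UNIV :: bool set)) r"
    using alg_independent_exists[of "?V \<times> (UNIV :: bool set)"] fin by auto
  define place where "place x = (\<lambda>(u, k). if u = v then x k else r (u, k))" for x :: "bool \<Rightarrow> real"
  have place: "place x (v, k) = x k" "u \<noteq> v \<Longrightarrow> place x (u, k) = r (u, k)" for x u k
    by (auto simp: place_def)
  have IH: "stress_free ?V F' (place x)" if "sparse ?V F'" for F' x
    by (rule stress_free_cong[OF Suc(1)[OF cV that r]]) (auto simp: place)
  have edge: "\<exists>u\<in>?V. e = {v, u}" if "e \<in> F" "v \<in> e" for e
  proof -
    have "card e = 2" "e \<subseteq> V" using that Suc(3) by (auto simp: sparse_def finite_simple_graph_def)
    then show ?thesis using that(2) by (auto simp: card_2_iff)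
  qed
  have "\<exists>q0. stress_free V F q0"
  proof (cases "card {e \<in> F. v \<in> e} = 3")
    case True
    obtain a b c where abc: "a \<in> ?V" "b \<in> ?V" "c \<in> ?V" "a \<noteq> b" "a \<noteq> c" "b \<noteq> c"
      "{e \<in> F. v \<in> e} = {{v, a}, {v, b}, {v, c}}" "{a, b} \<notin> F" "sparse ?V (insert {a, b} ?F)"
      using sparse_inverse_1_extension[OF Suc(3) v(1) True] by blast
    let ?q = "place (\<lambda>k. (r (a, k) + r (b, k)) / 2)"
    have "stress_free V F ?q"
    proof (rule stress_free_1_extension[OF fin(1) v(1) abc(1-8) IH[OF abc(9)]])
      show "area ?q a b c \<noteq> 0"
        using generic_not_collinear[OF r abc(1-6)] abc(1-3) by (simp add: area_def place)
      show "?q (v, k) = (?q (a, k) + ?q (b, k)) / 2" for k using abc(1,2) by (simp add: place)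
    qed
    then show ?thesis by blast
  next
    case False
    then have "card {e \<in> F. v \<in> e} \<le> 2" using v by simp
    then consider (two) a b where "a \<in> ?V" "b \<in> ?V" "a \<noteq> b" "{e \<in> F. v \<in> e} \<subseteq> {{v, a}, {v, b}}"
      | (one) a where "a \<in> ?V" "{e \<in> F. v \<in> e} \<subseteq> {{v, a}}"
      | (zero) "{e \<in> F. v \<in> e} = {}"
    proof -
      assume le: "card {e \<in> F. v \<in> e} \<le> 2"
      then consider "card {e \<in> F. v \<in> e} = 2" | "card {e \<in> F. v \<in> e} = 1" | "card {e \<in> F. v \<in> e} = 0" by linarith
      then show ?thesis
      proof cases
        case 1
        then obtain e f where ef: "{e \<in> F. v \<in> e} = {e, f}" "e \<noteq> f" by (auto simp: card_2_iff)
        then have "e \<in> F \<and> v \<in> e" "f \<in> F \<and> v \<in> f" by auto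
        then obtain a b where "a \<in> ?V" "e = {v, a}" "b \<in> ?V" "f = {v, b}" using edge by meson
        then show ?thesis using two[of a b] ef by auto
      next
        case 2
        then obtain e where e: "{e \<in> F. v \<in> e} = {e}" by (auto simp: card_1_singleton_iff)
        then have "e \<in> F \<and> v \<in> e" by auto
        then obtain a where "a \<in> ?V" "e = {v, a}" using edge by meson
        then show ?thesis using one[of a] e by auto
      next
        case 3
        then show ?thesis using zero fin by simp
      qed
    qed
    then show ?thesis
    proof cases
      case two
      \<comment> \<open>\<open>v\<close> sits one unit above \<open>a\<close>. The first coordinate
        of the balance then involves only the edge to \<open>b\<close>, whose first coordinate
        differs from that of \<open>a\<close>; the second coordinate afterwards isolates the edge to
        \<open>a\<close>.\<close>
      define x where "x k = r (a, k) + (if k then 1 else 0)" for k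
      have "stress_free V F (place x)"
      proof (rule stress_free_0_extension[OF fin(1) v(1) IH[OF sparse_delete_vertex[OF Suc(3)]]])
        fix \<omega> assume supp: "\<And>e. e \<notin> F \<Longrightarrow> \<omega> e = 0"
          and eq: "\<And>k. (\<Sum>w\<in>V. \<omega> {v, w} * (place x (v, k) - place x (w, k))) = 0"
        have o: "\<omega> {v, w} = 0" if "w \<notin> {a, b}" for w
        proof (rule ccontr)
          assume "\<omega> {v, w} \<noteq> 0"
          then have "{v, w} \<in> {e \<in> F. v \<in> e}" using supp by auto
          then have "{v, w} \<in> {{v, a}, {v, b}}" using two(4) by (rule subsetD[rotated])
          then show False using that two by (auto simp: doubleton_eq_iff)
        qed
        have eq2: "\<omega> {v, a} * (x k - r (a, k)) + \<omega> {v, b} * (x k - r (b, k)) = 0" for k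
        proof -
          have "0 = (\<Sum>w\<in>V. \<omega> {v, w} * (place x (v, k) - place x (w, k)))" using eq by simp
          also have "\<dots> = (\<Sum>w\<in>{a, b}. \<omega> {v, w} * (place x (v, k) - place x (w, k)))"
            using fin(1) two o by (intro sum.mono_neutral_right) auto
          finally show ?thesis using two by (simp add: place)
        qed
        have "\<omega> {v, b} = 0"
          using eq2[of False] generic_first_coordinates_differ[OF r two(1-3)] by (simp add: x_def)
        moreover from this have "\<omega> {v, a} = 0" using eq2[of True] by (simp add: x_def)
        ultimately show "\<forall>e\<in>F. v \<in> e \<longrightarrow> \<omega> e = 0" using two(4) by auto
      qed
      then show ?thesis by blast
    next
      case one
      \<comment> \<open>Any position of \<open>v\<close> away from \<open>a\<close> would do; the
        second coordinate of the offset is the one used below.\<close>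
      define x where "x k = r (a, k) + 1" for k
      have "stress_free V F (place x)"
      proof (rule stress_free_0_extension[OF fin(1) v(1) IH[OF sparse_delete_vertex[OF Suc(3)]]])
        fix \<omega> assume supp: "\<And>e. e \<notin> F \<Longrightarrow> \<omega> e = 0"
          and eq: "\<And>k. (\<Sum>w\<in>V. \<omega> {v, w} * (place x (v, k) - place x (w, k))) = 0"
        have o: "\<omega> {v, w} = 0" if "w \<noteq> a" for w
        proof (rule ccontr)
          assume "\<omega> {v, w} \<noteq> 0"
          then have "{v, w} \<in> {e \<in> F. v \<in> e}" using supp by auto
          then have "{v, w} \<in> {{v, a}}" using one(2) by (rule subsetD[rotated])
          then show False using that one by (auto simp: doubleton_eq_iff)
        qed
        have "0 = (\<Sum>w\<in>V. \<omega> {v, w} * (place x (v, True) - place x (w, True)))" using eq by simp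
        also have "\<dots> = (\<Sum>w\<in>{a}. \<omega> {v, w} * (place x (v, True) - place x (w, True)))"
          using fin(1) one o by (intro sum.mono_neutral_right) auto
        finally have "\<omega> {v, a} = 0" using one by (simp add: place x_def)
        then show "\<forall>e\<in>F. v \<in> e \<longrightarrow> \<omega> e = 0" using one(2) by auto
      qed
      then show ?thesis by blast
    next
      case zero
      have "stress_free V F (place (\<lambda>_. 0))"
        by (rule stress_free_0_extension[OF fin(1) v(1) IH[OF sparse_delete_vertex[OF Suc(3)]]])
          (use zero in auto)
      then show ?thesis by blast
    qed
  qed
  then show ?case using stress_free_generic[OF fin] Suc(4) by blast
qed

section \<open>The rank of the rigidity matrix\<close>

text \<open>The columns of \<open>A * B\<close> are combinations of those of \<open>A\<close>, so
  the column spaces are nested.\<close>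

lemma (in vec_space) rank_mult_le:
  assumes A: "A \<in> carrier_mat n nc" and B: "B \<in> carrier_mat nc k"
  shows "rank (A * B) \<le> rank A"
proof -
  have AB: "A * B \<in> carrier_mat n k" using A B by simp
  have colsA: "set (cols A) \<subseteq> carrier_vec n" using A cols_dim[of A] by auto
  have "set (cols (A * B)) \<subseteq> span (set (cols A))"
  proof
    fix x assume "x \<in> set (cols (A * B))"
    then obtain j where j: "j < k" "x = col (A * B) j" using AB by (auto simp: cols_def)
    have "x = A *\<^sub>v col B j" unfolding j(2) by (rule eq_vecI) (use j(1) A B in auto)
    also have "\<dots> \<in> col_space A" unfolding col_space_eq[OF A] using A B j(1) by auto
    also have "col_space A = span (set (cols A))" by (rule col_space_def)
    finally show "x \<in> span (set (cols A))" .
  qed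
  then have sub: "span (set (cols (A * B))) \<subseteq> span (set (cols A))" by (rule span_subsetI[OF colsA])
  have sA: "VectorSpace.subspace class_ring (span (set (cols A))) V" using colsA span_is_subspace by simp
  have sAB: "VectorSpace.subspace class_ring (span (set (cols (A * B)))) V"
    using A cols_dim[of "A * B"] span_is_subspace by auto
  show ?thesis
    unfolding rank_def
    using vectorspace.subspace_dim[OF subspace_is_vs[OF sA] nested_subspaces[OF sA sAB sub]]
      fin_dim_span_cols[OF A] fin_dim_span_cols[OF AB] by simp
qed

text \<open>The Gram matrix of the rows in \<open>I\<close> is the submatrix of \<open>R * S\<close>
  on these rows, where \<open>S\<close> is their transpose. Its nonzero determinant gives
  \<open>R * S\<close> rank at least \<open>card I\<close>, and \<open>R\<close> has at least the
  rank of the product.\<close>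

lemma rank_ge_gram:
  fixes R :: "real mat"
  assumes R: "R \<in> carrier_mat nr nc" and I: "I \<subseteq> {..<nr}"
    and det: "det (gram (card I) {..<nc} (\<lambda>i j. R $$ (pick I i, j))) \<noteq> 0"
  shows "card I \<le> vec_space.rank nr R"
proof -
  define S where "S = mat nc (card I) (\<lambda>(j, i). R $$ (pick I i, j))"
  have S: "S \<in> carrier_mat nc (card I)" by (simp add: S_def)
  have RS: "R * S \<in> carrier_mat nr (card I)" using R S by simp
  have dims: "dim_row (R * S) = nr" "dim_col (R * S) = card I" using RS by blast+
  have cI: "{i. i < nr \<and> i \<in> I} = I" using I by auto
  have picked: "pick I i < nr" if "i < card I" for i
    using pick_le[of i nr I] that cI by simp
  have "submatrix (R * S) I UNIV = gram (card I) {..<nc} (\<lambda>i j. R $$ (pick I i, j))"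
  proof (rule eq_matI)
    fix i j assume "i < dim_row (gram (card I) {..<nc} (\<lambda>i j. R $$ (pick I i, j)))"
      "j < dim_col (gram (card I) {..<nc} (\<lambda>i j. R $$ (pick I i, j)))"
    then have ij: "i < card I" "j < card I" by (auto simp: gram_def)
    have "submatrix (R * S) I UNIV $$ (i, j) = (R * S) $$ (pick I i, j)"
      using ij dims submatrix_index[of i "R * S" I j UNIV] by (simp add: cI pick_UNIV)
    also have "\<dots> = (\<Sum>c<nc. R $$ (pick I i, c) * R $$ (pick I j, c))"
      using ij picked R S by (simp add: scalar_prod_def S_def lessThan_atLeast0)
    finally show "submatrix (R * S) I UNIV $$ (i, j) = gram (card I) {..<nc} (\<lambda>i j. R $$ (pick I i, j)) $$ (i, j)"
      using ij by (simp add: gram_def)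
  qed (use R S in \<open>simp_all add: dim_submatrix gram_def cI\<close>)
  then have "card {j. j < card I \<and> j \<in> UNIV} \<le> vec_space.rank nr (R * S)"
    using vec_space.rank_gt_minor[OF RS, of I UNIV] det by simp
  also have "\<dots> \<le> vec_space.rank nr R" by (rule vec_space.rank_mult_le[OF R S])
  finally show ?thesis by simp
qed

definition edge_index_pairs :: "'v list \<Rightarrow> 'v set set \<Rightarrow> (nat \<times> nat) list" where
  "edge_index_pairs vs E = [(i, j). i \<leftarrow> [0..<length vs], j \<leftarrow> [Suc i..<length vs], {vs ! i, vs ! j} \<in> E]"

lemma rigidity_matrix_alt:
  "rigidity_matrix vs E p = mat_of_rows (2 * length vs) (map (\<lambda>(i, j). edge_vector vs p i j) (edge_index_pairs vs E))"
  unfolding rigidity_matrix_def edge_index_pairs_def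
  by (simp add: map_concat o_def if_distrib[of "map _"] cong: if_cong)

lemma set_edge_index_pairs:
  "set (edge_index_pairs vs E) = {(i, j). i < j \<and> j < length vs \<and> {vs ! i, vs ! j} \<in> E}"
  by (auto simp: edge_index_pairs_def split: if_splits)

lemma distinct_edge_index_pairs: "distinct (edge_index_pairs vs E)"
proof -
  have "distinct (concat (map (\<lambda>i. concat (map (\<lambda>j. if P i j then [(i, j)] else []) (f i))) is))"
    if "distinct is" "\<And>i. distinct (f i)" for P and f :: "nat \<Rightarrow> nat list" and "is" :: "nat list"
  proof -
    have d: "distinct (concat (map (\<lambda>j. if P i j then [(i, j)] else []) js))" if "distinct js" for i js
      using that by (induction js) auto
    show ?thesis using that(1) by (induction "is") (use d[OF that(2)] in \<open>auto split: if_splits\<close>)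
  qed
  then show ?thesis unfolding edge_index_pairs_def by simp
qed

text \<open>Column \<open>c\<close> belongs to vertex \<open>vs ! (c div 2)\<close>, and odd columns
  to second coordinates, the index \<open>True\<close>. Swapping the ends changes no entry, since
  each difference is taken from the vertex that owns the column.\<close>

lemma edge_vector_index:
  assumes vs: "distinct vs" "set vs = V" and ij: "i < j" "j < length vs" and c: "c < 2 * length vs"
    and q: "q = (\<lambda>(v, b). if b then snd (p v) else fst (p v))"
  shows "edge_vector vs p i j $ c = row_entry V q {vs ! i, vs ! j} (vs ! (c div 2), odd c)"
proof -
  define m where "m = c div 2"
  have m: "m < length vs" using c by (simp add: m_def)
  have fin: "finite V" using vs by auto
  have "{vs ! m, w} = {vs ! i, vs ! j} \<longleftrightarrow> (m = i \<and> w = vs ! j) \<or> (m = j \<and> w = vs ! i)" for w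
    using vs(1) m ij by (auto simp: doubleton_eq_iff nth_eq_iff_index_eq)
  then have re: "row_entry V q {vs ! i, vs ! j} (vs ! m, k)
      = (\<Sum>w\<in>V. if (m = i \<and> w = vs ! j) \<or> (m = j \<and> w = vs ! i) then q (vs ! m, k) - q (w, k) else 0)" for k
    by (simp add: row_entry_def)
  have row: "row_entry V q {vs ! i, vs ! j} (vs ! m, k)
      = (if m = i then q (vs ! i, k) - q (vs ! j, k) else if m = j then q (vs ! j, k) - q (vs ! i, k) else 0)" for k
    unfolding re using fin ij vs(2) by auto
  have c_eq: "c = 2 * l \<longleftrightarrow> m = l \<and> even c" "c = Suc (2 * l) \<longleftrightarrow> m = l \<and> odd c" for l
    unfolding m_def by presburger+
  show ?thesis
    unfolding m_def[symmetric] row using c ij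
    by (auto simp: edge_vector_def Let_def c_eq q)
qed

text \<open>\<open>pick I\<close> lists the rows of the edges in \<open>F\<close> in increasing
  order, and the bijection between columns and \<open>V \<times> UNIV\<close> identifies their Gram
  matrix with the one that decides \<open>stress_free\<close>.\<close>

lemma stress_free_card_le_rank:
  assumes vs: "distinct vs" "set vs = V" and E: "finite_simple_graph V E" and F: "F \<subseteq> E"
    and free: "stress_free V F (\<lambda>(v, b). if b then snd (p v) else fst (p v))"
  shows "card F \<le> vec_space.rank (dim_row (rigidity_matrix vs E p)) (rigidity_matrix vs E p)"
proof -
  define q where "q = (\<lambda>(v, b). if b then snd (p v) else fst (p v))"
  define ps where "ps = edge_index_pairs vs E"
  define es where "es = map (\<lambda>(i, j). {vs ! i, vs ! j}) ps"
  define R where "R = rigidity_matrix vs E p"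
  define N where "N = 2 * length vs"
  have R: "R \<in> carrier_mat (length es) N"
    by (rule carrier_matI) (simp_all add: R_def rigidity_matrix_alt es_def ps_def N_def)
  have R_index: "R $$ (t, c) = row_entry V q (es ! t) (vs ! (c div 2), odd c)" if t: "t < length es" "c < N" for t c
  proof -
    obtain i j where ij: "ps ! t = (i, j)" by fastforce
    then have "(i, j) \<in> set ps" using t by (metis es_def length_map nth_mem)
    then have ij': "i < j" "j < length vs" by (auto simp: ps_def set_edge_index_pairs)
    have "R $$ (t, c) = edge_vector vs p i j $ c"
      using t ij by (simp add: R_def rigidity_matrix_alt es_def ps_def N_def mat_of_rows_index)
    also have "\<dots> = row_entry V q {vs ! i, vs ! j} (vs ! (c div 2), odd c)"
      using edge_vector_index[OF vs ij' _ q_def] t by (simp add: N_def)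
    finally show ?thesis using t ij by (simp add: es_def)
  qed
  have "distinct es"
    unfolding es_def distinct_map
  proof
    show "distinct ps" by (simp add: ps_def distinct_edge_index_pairs)
    show "inj_on (\<lambda>(i, j). {vs ! i, vs ! j}) (set ps)"
      using vs(1) by (auto simp: inj_on_def ps_def set_edge_index_pairs doubleton_eq_iff nth_eq_iff_index_eq)
  qed
  have "E \<subseteq> set es"
  proof
    fix e assume e: "e \<in> E"
    then have "card e = 2" "e \<subseteq> set vs" using E vs by (auto simp: finite_simple_graph_def)
    then obtain a b where ab: "e = {a, b}" "a \<noteq> b" "a \<in> set vs" "b \<in> set vs" by (auto simp: card_2_iff)
    then obtain i j where ij: "i < length vs" "vs ! i = a" "j < length vs" "vs ! j = b" by (metis in_set_conv_nth)
    then have "i \<noteq> j" using ab by auto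
    then have "(i, j) \<in> set ps \<or> (j, i) \<in> set ps"
      using ij ab e by (auto simp: ps_def set_edge_index_pairs insert_commute)
    then show "e \<in> set es" using ij ab by (force simp: es_def insert_commute)
  qed
  then have F_es: "F \<subseteq> set es" using F by blast
  define I where "I = {t. t < length es \<and> es ! t \<in> F}"
  have I: "I \<subseteq> {..<length es}" "finite I" by (auto simp: I_def)
  define fs where "fs = map (\<lambda>i. es ! pick I i) [0..<card I]"
  have pickI: "pick I i \<in> I" if "i < card I" for i using that by (rule pick_in_set_le)
  have pick_inj: "i = j" if "pick I i = pick I j" "i < card I" "j < card I" for i j
    using that by (metis linorder_neqE_nat nat_neq_iff pick_mono_le)
  have "distinct fs"
    unfolding fs_def distinct_map
  proof
    show "inj_on (\<lambda>i. es ! pick I i) (set [0..<card I])"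
    proof (rule inj_onI)
      fix i j assume ij: "i \<in> set [0..<card I]" "j \<in> set [0..<card I]" "es ! pick I i = es ! pick I j"
      then have "pick I i \<in> I" "pick I j \<in> I" using pickI by auto
      then have "pick I i = pick I j" using ij(3) \<open>distinct es\<close> by (auto simp: I_def nth_eq_iff_index_eq)
      then show "i = j" using pick_inj ij by auto
    qed
  qed simp
  have "set fs = F"
  proof
    show "set fs \<subseteq> F" using pickI by (auto simp: fs_def I_def)
    show "F \<subseteq> set fs"
    proof
      fix f assume "f \<in> F"
      then obtain t where t: "t < length es" "es ! t = f" using F_es by (metis in_set_conv_nth subsetD)
      then have tI: "t \<in> I" using \<open>f \<in> F\<close> by (simp add: I_def)
      \<comment> \<open>The element \<open>t\<close> of \<open>I\<close> is picked at the position
        that counts the smaller elements of \<open>I\<close>.\<close>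
      have "{a \<in> I. a < t} \<subset> I" using tI by auto
      then have "card {a \<in> I. a < t} < card I" using I by (intro psubset_card_mono)
      then show "f \<in> set fs" using t pick_card_in_set[OF tI] by (force simp: fs_def)
    qed
  qed
  have len: "length fs = card I" by (simp add: fs_def)
  have "card F = card I" using distinct_card[OF \<open>distinct fs\<close>] \<open>set fs = F\<close> len by simp
  have bij: "bij_betw (\<lambda>c. (vs ! (c div 2), odd c)) {..<N} (V \<times> UNIV)"
  proof (rule bij_betwI')
    show "((vs ! (c div 2), odd c) = (vs ! (d div 2), odd d)) = (c = d)" if "c \<in> {..<N}" "d \<in> {..<N}" for c d
    proof
      assume "(vs ! (c div 2), odd c) = (vs ! (d div 2), odd d)"
      then have "c div 2 = d div 2" "odd c = odd d" using that vs(1) by (auto simp: N_def nth_eq_iff_index_eq)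
      then show "c = d" by presburger
    qed simp
    show "(vs ! (c div 2), odd c) \<in> V \<times> UNIV" if "c \<in> {..<N}" for c using that vs by (auto simp: N_def)
    show "\<exists>c\<in>{..<N}. x = (vs ! (c div 2), odd c)" if x: "x \<in> V \<times> UNIV" for x
    proof -
      obtain v k where vk: "x = (v, k)" "v \<in> set vs" using x vs by auto
      then obtain m where "m < length vs" "vs ! m = v" by (auto simp: in_set_conv_nth)
      then show ?thesis using vk by (intro bexI[of _ "2 * m + of_bool k"]) (cases k, auto simp: N_def)
    qed
  qed
  have "gram (card I) {..<N} (\<lambda>i c. R $$ (pick I i, c)) = gram (length fs) (V \<times> UNIV) (\<lambda>i. row_entry V q (fs ! i))"
    unfolding gram_def len
  proof (rule cong_mat)
    fix i j assume ij: "i < card I" "j < card I"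
    have lt: "pick I i < length es" "pick I j < length es" using pickI ij by (auto simp: I_def)
    have "(\<Sum>c<N. R $$ (pick I i, c) * R $$ (pick I j, c))
        = (\<Sum>c<N. row_entry V q (fs ! i) (vs ! (c div 2), odd c) * row_entry V q (fs ! j) (vs ! (c div 2), odd c))"
      using ij lt by (intro sum.cong) (auto simp: R_index fs_def)
    also have "\<dots> = (\<Sum>x\<in>V \<times> UNIV. row_entry V q (fs ! i) x * row_entry V q (fs ! j) x)"
      by (rule sum.reindex_bij_betw[OF bij])
    finally show "(case (i, j) of (i, j) \<Rightarrow> \<Sum>x<N. R $$ (pick I i, x) * R $$ (pick I j, x))
        = (case (i, j) of (i, j) \<Rightarrow> \<Sum>x\<in>V \<times> UNIV. row_entry V q (fs ! i) x * row_entry V q (fs ! j) x)" by simp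
  qed auto
  moreover have "finite V" using vs by auto
  ultimately have "det (gram (card I) {..<N} (\<lambda>i c. R $$ (pick I i, c))) \<noteq> 0"
    using free stress_free_iff_det_gram[OF _ \<open>distinct fs\<close> \<open>set fs = F\<close>, of V q] by (simp add: q_def)
  then have "card I \<le> vec_space.rank (length es) R" by (rule rank_ge_gram[OF R I(1)])
  then show ?thesis using \<open>card F = card I\<close> R by (simp add: R_def)
qed

theorem theorem2:
  fixes V :: "'v set" and E :: "'v set set"
  assumes "finite_simple_graph V E"
    and "connected_graph V E"
    and "regular_graph V E 5"
  shows "real (generic_rigidity_rank V E) \<ge> 5 / 3 * real (card V) - 1"
proof (cases "V = {}")
  case True
  then show ?thesis by simp
next
  case False
  have finV: "finite V" using assms(1) by (simp add: finite_simple_graph_def)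
  \<comment> \<open>These are the choices made inside \<open>generic_rigidity_rank\<close>; they
    have the intended properties because an enumeration and a generic realization exist.\<close>
  define vs where "vs = (SOME vs. distinct vs \<and> set vs = V)"
  define p where "p = (SOME p. generic_realization V p)"
  have "\<exists>vs. distinct vs \<and> set vs = V" using finite_distinct_list[OF finV] by blast
  then have vs: "distinct vs" "set vs = V" unfolding vs_def by (metis (mono_tags, lifting) someI_ex)+
  have p: "generic_realization V p"
    unfolding p_def using generic_realization_exists[OF finV] by (rule someI_ex)
  have rank: "generic_rigidity_rank V E = vec_space.rank (dim_row (rigidity_matrix vs E p)) (rigidity_matrix vs E p)"
    by (simp add: generic_rigidity_rank_def Let_def vs_def p_def)
  obtain F XX where F: "F \<subseteq> E" "sparse V F"
    and XX: "\<And>X. X \<in> XX \<Longrightarrow> X \<subseteq> V \<and> 2 \<le> card X" "\<And>e. e \<in> E \<Longrightarrow> \<exists>X\<in>XX. e \<subseteq> X"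
    and le: "(\<Sum>X\<in>XX. 2 * real (card X) - 3) \<le> real (card F)"
    using maximal_sparse_cover[OF assms(1)] by metis
  interpret covered_quintic_graph V E XX
    by unfold_locales (use assms XX in auto)
  have "5 / 3 * real (card V) - 1 \<le> real (card F)" using cover_weight_ge[OF False] le by linarith
  also have "card F \<le> generic_rigidity_rank V E"
    unfolding rank using p
    by (intro stress_free_card_le_rank[OF vs assms(1) F(1)] sparse_imp_stress_free[OF F(2)])
      (simp add: generic_realization_def)
  finally show ?thesis by simp
qed

end
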